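(* Let $\{\Psi_{[t]}\}_{t\in(0,1]}$ be the family of $2\times2$ rational (very badly approximable) matrix functions $$\Psi_{[t]}=\begin{pmatrix}\boldsymbol w^\#&\xi\end{pmatrix}\begin{pmatrix}u_0&0\\0&tu_1\end{pmatrix}\begin{pmatrix}\boldsymbol v^*\\ \vartheta^{\mathrm t}\end{pmatrix},$$ where $u_0,u_1,\boldsymbol v,\boldsymbol w,\xi,\vartheta$ are as described in the context. Then $$\sum_{t\in(0,1]}\big[\deg\mathbb P_+\Psi_{[t]}+2-\deg\mathbb P_-\Psi_{[t]}\big]_+\le\deg\mathbb P_-u_1,$$ where $[x]_+=\max\{x,0\}$ for $x\in\mathbb R$.
   Context: $\mathbb D$ is the open unit disk, $\mathbb T$ the unit circle, $\hat{\mathbb C}$ the Riemann sphere. For a matrix function $\Phi$ on $\mathbb T$ with Fourier coefficients $\hat\Phi(j)$, $(\mathbb P_+\Phi)(z)=\sum_{j\ge0}\hat\Phi(j)z^j$ and $\mathbb P_-\Phi=\Phi-\mathbb P_+\Phi$. For a rational matrix function $G$, $G^\#(\zeta)=\overline{G(1/\bar\zeta)}$ (entrywise conjugation) and $G^*=(G^\#)^{\mathrm t}$; these are rational. Data: $u_0,u_1$ are scalar rational functions with $|u_0|=|u_1|=1$ on $\mathbb T$ that are badly approximable, i.e. $\operatorname{dist}_{L^\infty(\mathbb T)}(u_j,H^\infty)=\|u_j\|_{L^\infty}$. $\boldsymbol v=\binom{v_1}{v_2}$ and $\boldsymbol w=\binom{w_1}{w_2}$ are rational inner and co-outer column functions: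 $v_1,v_2,w_1,w_2$ are rational functions in $H^\infty$ with $|v_1|^2+|v_2|^2=|w_1|^2+|w_2|^2=1$ on $\mathbb T$, $v_1,v_2$ have no common zeros in $\mathbb D$, and $w_1,w_2$ have no common zeros in $\mathbb D$. Finally $\xi=\binom{-w_2}{w_1}$ and $\vartheta=\binom{-v_2}{v_1}$. (It is known that $\Psi_{[t]}$ is then very badly approximable for $0<t\le1$, i.e. the zero function is a superoptimal approximant of $\Psi_{[t]}$; this is not an additional hypothesis.) McMillan degree: a finite Blaschke–Potapov product of size $n\times n$ is $B=UB_1\cdots B_k$ with $U$ a constant unitary matrix and $B_j(z)=\frac{\lambda_j-z}{1-\bar\lambda_jz}P_j+(I-P_j)$, $\lambda_j\in\mathbb D$, $P_j$ orthogonal projections on $\mathbb C^n$; $\deg B=\sum_j\operatorname{rank}P_j$. If all poles (in $\hat{\mathbb C}$) of a rational $m\times n$ matrix function $\Phi$ lie in $\mathbb D$, $\deg\Phi$ is the smallest degree of an $n\times n$ finite Blaschke–Potapov product $B$ such that $\Phi B$ is bounded and analytic in $\mathbb D$ (constants have degree $0$). If $\Phi$ has no poles in the closed unit disk, $\deg\Phi=\deg\Phi_\flat$ with $\Phi_\flat(z)=\Phi(1/z)$. *)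

theory Defs
  imports
    "HOL-Computational_Algebra.Computational_Algebra"
    "HOL-Computational_Algebra.Field_as_Ring"
    "HOL-Complex_Analysis.Complex_Analysis"
    "HOL-Probability.Essential_Supremum"
begin

unbundle no fps_syntax

text \<open>
  A rational function is an element of the field of fractions of the complex polynomials, so that
  sums, products and matrix products of rational functions carry no exceptional points.
  Values are taken in lowest terms: removable singularities are filled in, and the value at a pole
  is the conventional \<open>x / 0 = 0\<close>.
\<close>

type_synonym ratfun = "complex poly fract"

definition rat_eval :: "ratfun \<Rightarrow> complex \<Rightarrow> complex" where
  "rat_eval r z = poly (fst (quot_of_fract r)) z / poly (snd (quot_of_fract r)) z"

definition rat_const :: "complex \<Rightarrow> ratfun" where
  "rat_const c = to_fract [:c:]"

definition rat_z :: ratfun where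
  "rat_z = to_fract [:0, 1:]"

definition rat_subst :: "complex poly \<Rightarrow> ratfun \<Rightarrow> ratfun" where
  "rat_subst p r = poly (map_poly rat_const p) r"

text \<open>The rational function \<open>r (1 / z)\<close>; see \<open>rat_eval_flat\<close> below.\<close>

definition rat_flat :: "ratfun \<Rightarrow> ratfun" where
  "rat_flat r =
     rat_subst (fst (quot_of_fract r)) (1 / rat_z) / rat_subst (snd (quot_of_fract r)) (1 / rat_z)"

text \<open>The rational function \<open>cnj (r (1 / cnj z))\<close>; see \<open>rat_eval_sharp\<close> below.\<close>

definition rat_sharp :: "ratfun \<Rightarrow> ratfun" where
  "rat_sharp r =
     rat_subst (map_poly cnj (fst (quot_of_fract r))) (1 / rat_z)
       / rat_subst (map_poly cnj (snd (quot_of_fract r))) (1 / rat_z)"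

lemma rat_eval_divide:
  assumes "poly q z \<noteq> 0"
  shows "rat_eval (to_fract p / to_fract q) z = poly p z / poly q z"
proof -
  define r where "r = to_fract p / to_fract q"
  define a where "a = fst (quot_of_fract r)"
  define b where "b = snd (quot_of_fract r)"
  have q0: "q \<noteq> 0" using assms by auto
  have b0: "b \<noteq> 0" by (simp add: b_def)
  have r1: "r = Fract a b" by (simp add: a_def b_def)
  have r2: "r = Fract p q" using q0 by (simp add: r_def to_fract_def)
  have "a * q = p * b" using r1 r2 q0 b0 by (simp add: eq_fract)
  hence e: "poly a z * poly q z = poly p z * poly b z" by (metis poly_mult)
  have cop: "coprime a b" unfolding a_def b_def by (rule coprime_quot_of_fract)
  have "poly b z \<noteq> 0"
  proof
    assume "poly b z = 0"
    with e assms have "poly a z = 0" by simp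
    with \<open>poly b z = 0\<close> have "[:-z, 1:] dvd a" "[:-z, 1:] dvd b" by (simp_all add: poly_eq_0_iff_dvd)
    with cop have "is_unit [:-z, 1:]" by (rule coprime_common_divisor)
    thus False by (auto simp: is_unit_poly_iff)
  qed
  thus ?thesis using e assms
    by (simp add: rat_eval_def a_def[symmetric] b_def[symmetric] r_def[symmetric] field_simps)
qed

lemma add_inverse_mult_divide:
  fixes a c x y :: "'a::field"
  assumes "x \<noteq> 0" "y \<noteq> 0"
  shows "c + 1 / x * (a / y) = (c * (x * y) + a) / (x * y)"
proof -
  have "(c * (x * y) + a) / (x * y) = c * (x * y) / (x * y) + a / (x * y)"
    by (rule add_divide_distrib)
  thus ?thesis using assms by simp
qed

lemma rat_subst_inverse_eq:
  assumes "z \<noteq> 0"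
  obtains a b where "rat_subst p (1 / rat_z) = to_fract a / to_fract b" "poly b z \<noteq> 0"
    "poly a z / poly b z = poly p (1 / z)"
proof -
  have "\<exists>a n. rat_subst p (1 / rat_z) = to_fract a / to_fract ([:0, 1:] ^ n)
              \<and> poly a z / z ^ n = poly p (1 / z)"
  proof (induction p)
    case 0
    show ?case by (rule exI[of _ 0], rule exI[of _ 0]) (simp add: rat_subst_def)
  next
    case (pCons c p)
    then obtain a n where an: "rat_subst p (1 / rat_z) = to_fract a / to_fract ([:0, 1:] ^ n)"
      "poly a z / z ^ n = poly p (1 / z)" by blast
    have "rat_subst (pCons c p) (1 / rat_z) = rat_const c + 1 / rat_z * rat_subst p (1 / rat_z)"
      using pCons(1) by (auto simp: rat_subst_def map_poly_pCons rat_const_def)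
    also have "\<dots> = to_fract ([:c:] * [:0, 1:] ^ Suc n + a) / to_fract ([:0, 1:] ^ Suc n)"
    proof -
      have nz: "to_fract [:0, 1::complex:] \<noteq> 0" "to_fract ([:0, 1::complex:] ^ n) \<noteq> 0" by auto
      show ?thesis unfolding an(1) unfolding rat_z_def rat_const_def power_Suc to_fract_add to_fract_mult
        by (rule add_inverse_mult_divide[OF nz])
    qed
    finally have 1: "rat_subst (pCons c p) (1 / rat_z) = \<dots>" .
    have "poly ([:c:] * [:0, 1:] ^ Suc n + a) z / z ^ Suc n = (c * (z * z ^ n) + poly a z) / (z * z ^ n)"
      by simp
    also have "\<dots> = c + 1 / z * (poly a z / z ^ n)"
      by (rule add_inverse_mult_divide[symmetric]) (use assms in simp_all)
    also have "\<dots> = poly (pCons c p) (1 / z)" by (simp add: an(2))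
    finally show ?case using 1 by blast
  qed
  then obtain a n where an: "rat_subst p (1 / rat_z) = to_fract a / to_fract ([:0, 1:] ^ n)"
      "poly a z / z ^ n = poly p (1 / z)" by blast
  show ?thesis by (rule that[OF an(1)]) (use an assms in simp_all)
qed

lemma rat_eval_subst_divide:
  assumes "z \<noteq> 0" "poly q (1 / z) \<noteq> 0"
  shows "rat_eval (rat_subst p (1 / rat_z) / rat_subst q (1 / rat_z)) z
         = poly p (1 / z) / poly q (1 / z)"
proof -
  obtain a b where ab: "rat_subst p (1 / rat_z) = to_fract a / to_fract b" "poly b z \<noteq> 0"
    "poly a z / poly b z = poly p (1 / z)" using rat_subst_inverse_eq assms(1) by blast
  obtain c d where cd: "rat_subst q (1 / rat_z) = to_fract c / to_fract d" "poly d z \<noteq> 0"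
    "poly c z / poly d z = poly q (1 / z)" using rat_subst_inverse_eq assms(1) by blast
  have bc: "poly (b * c) z \<noteq> 0" using ab cd assms by auto
  have "rat_subst p (1 / rat_z) / rat_subst q (1 / rat_z) = to_fract (a * d) / to_fract (b * c)"
    by (simp add: ab(1) cd(1))
  hence "rat_eval (rat_subst p (1 / rat_z) / rat_subst q (1 / rat_z)) z
         = poly (a * d) z / poly (b * c) z"
    using rat_eval_divide[OF bc] by metis
  also have "\<dots> = (poly a z / poly b z) / (poly c z / poly d z)" by simp
  finally show ?thesis unfolding ab(3) cd(3) .
qed

lemma rat_eval_flat:
  assumes "z \<noteq> 0" "poly (snd (quot_of_fract r)) (1 / z) \<noteq> 0"
  shows "rat_eval (rat_flat r) z = rat_eval r (1 / z)"
  unfolding rat_flat_def rat_eval_subst_divide[OF assms] by (simp add: rat_eval_def)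

lemma rat_eval_sharp:
  assumes "z \<noteq> 0" "poly (snd (quot_of_fract r)) (1 / cnj z) \<noteq> 0"
  shows "rat_eval (rat_sharp r) z = cnj (rat_eval r (1 / cnj z))"
  using assms unfolding rat_sharp_def
  by (subst rat_eval_subst_divide) (simp_all add: rat_eval_def)

text \<open>Normalized Lebesgue measure on the unit circle, as a Borel measure on the plane.\<close>

definition circle_measure :: "complex measure" where
  "circle_measure = distr (uniform_measure lborel {0..2 * pi}) borel cis"

definition fourier_coeff :: "(complex \<Rightarrow> complex) \<Rightarrow> int \<Rightarrow> complex" where
  "fourier_coeff f j = integral\<^sup>L circle_measure (\<lambda>z. f z * z powi (- j))"

definition Hinf :: "(complex \<Rightarrow> complex) set" where
  "Hinf = {f. f holomorphic_on ball 0 1 \<and> bounded (f ` ball 0 1)}"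

text \<open>\<open>H\<^sup>\<infinity>\<close> as a space of functions on the circle, via radial boundary values.\<close>

definition Hinf_circle :: "(complex \<Rightarrow> complex) set" where
  "Hinf_circle = {g \<in> borel_measurable circle_measure.
     \<exists>f\<in>Hinf. AE \<zeta> in circle_measure. ((\<lambda>r. f (of_real r * \<zeta>)) \<longlongrightarrow> g \<zeta>) (at_left (1::real))}"

definition Linf_norm :: "(complex \<Rightarrow> complex) \<Rightarrow> ennreal" where
  "Linf_norm f = esssup circle_measure (\<lambda>\<zeta>. ennreal (norm (f \<zeta>)))"

definition badly_approximable :: "(complex \<Rightarrow> complex) \<Rightarrow> bool" where
  "badly_approximable u \<longleftrightarrow>
     (INF g\<in>Hinf_circle. Linf_norm (\<lambda>\<zeta>. u \<zeta> - g \<zeta>)) = Linf_norm u"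

text \<open>
  For \<open>r\<close> without poles on the circle, \<open>riesz_plus r\<close> is the rational function whose values on the
  circle are given by the analytic part of the Fourier series of \<open>r\<close>.
\<close>

definition riesz_plus :: "ratfun \<Rightarrow> ratfun" where
  "riesz_plus r = (THE s. \<forall>z\<in>sphere 0 1.
     (\<lambda>j. fourier_coeff (rat_eval r) (int j) * z ^ j) sums rat_eval s z)"

definition riesz_minus :: "ratfun \<Rightarrow> ratfun" where
  "riesz_minus r = r - riesz_plus r"

definition ctranspose :: "complex ^ 'n ^ 'm \<Rightarrow> complex ^ 'm ^ 'n" where
  "ctranspose A = map_matrix cnj (transpose A)"

definition unitary_matrix :: "complex ^ 'n ^ 'n \<Rightarrow> bool" where
  "unitary_matrix U \<longleftrightarrow> ctranspose U ** U = mat 1 \<and> U ** ctranspose U = mat 1"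

definition orth_projection :: "complex ^ 'n ^ 'n \<Rightarrow> bool" where
  "orth_projection P \<longleftrightarrow> P ** P = P \<and> ctranspose P = P"

definition bp_factor :: "complex \<Rightarrow> complex ^ 'n ^ 'n \<Rightarrow> ratfun ^ 'n ^ 'n" where
  "bp_factor \<alpha> P =
     map_matrix (\<lambda>p. (rat_const \<alpha> - rat_z) / (1 - rat_const (cnj \<alpha>) * rat_z) * rat_const p) P
     + map_matrix rat_const (mat 1 - P)"

text \<open>\<open>blaschke_potapov B d\<close>: \<open>B\<close> is a finite Blaschke--Potapov product of degree \<open>d\<close>.\<close>

inductive blaschke_potapov :: "ratfun ^ 'n ^ 'n \<Rightarrow> nat \<Rightarrow> bool" where
  const: "unitary_matrix U \<Longrightarrow> blaschke_potapov (map_matrix rat_const U) 0"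
| factor: "blaschke_potapov B d \<Longrightarrow> \<alpha> \<in> ball 0 1 \<Longrightarrow> orth_projection P \<Longrightarrow>
           blaschke_potapov (B ** bp_factor \<alpha> P) (d + rank P)"

definition poles_in_disk :: "ratfun ^ 'n ^ 'm \<Rightarrow> bool" where
  "poles_in_disk \<Phi> \<longleftrightarrow> (\<forall>i j.
     (\<forall>z. is_pole (rat_eval (\<Phi> $ i $ j)) z \<longrightarrow> z \<in> ball 0 1) \<and>
     \<not> filterlim (rat_eval (\<Phi> $ i $ j)) at_infinity at_infinity)"

definition no_poles_in_cdisk :: "ratfun ^ 'n ^ 'm \<Rightarrow> bool" where
  "no_poles_in_cdisk \<Phi> \<longleftrightarrow> (\<forall>i j. \<forall>z\<in>cball 0 1. \<not> is_pole (rat_eval (\<Phi> $ i $ j)) z)"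

definition bp_degree :: "ratfun ^ 'n ^ 'm \<Rightarrow> nat" where
  "bp_degree \<Phi> = (LEAST d. \<exists>B. blaschke_potapov B d \<and> (\<forall>i j. rat_eval ((\<Phi> ** B) $ i $ j) \<in> Hinf))"

text \<open>The two cases overlap only for constant \<open>\<Phi>\<close>, where both give degree \<open>0\<close>.\<close>

definition mcmillan_degree :: "ratfun ^ 'n ^ 'm \<Rightarrow> nat" where
  "mcmillan_degree \<Phi> =
     (if poles_in_disk \<Phi> then bp_degree \<Phi>
      else if no_poles_in_cdisk \<Phi> then bp_degree (map_matrix rat_flat \<Phi>)
      else undefined)"

definition inner_coouter_column :: "ratfun ^ 2 \<Rightarrow> bool" where
  "inner_coouter_column v \<longleftrightarrow>
     rat_eval (v $ 1) \<in> Hinf \<and> rat_eval (v $ 2) \<in> Hinf \<and>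
     (\<forall>z\<in>sphere 0 1. (norm (rat_eval (v $ 1) z))\<^sup>2 + (norm (rat_eval (v $ 2) z))\<^sup>2 = 1) \<and>
     \<not> (\<exists>z\<in>ball 0 1. rat_eval (v $ 1) z = 0 \<and> rat_eval (v $ 2) z = 0)"

definition complement_column :: "ratfun ^ 2 \<Rightarrow> ratfun ^ 2" where
  "complement_column v = vector [- v $ 2, v $ 1]"

definition sharp_vec :: "ratfun ^ 'n \<Rightarrow> ratfun ^ 'n" where
  "sharp_vec v = (\<chi> i. rat_sharp (v $ i))"

text \<open>\<open>vector\<close> lists rows; so the first factor has columns \<open>w\<^sup>#\<close> and \<open>\<xi>\<close>, the last one
  rows \<open>v\<^sup>*\<close> and \<open>\<vartheta>\<^sup>t\<close>.\<close>

definition Psi :: "ratfun \<Rightarrow> ratfun \<Rightarrow> ratfun ^ 2 \<Rightarrow> ratfun ^ 2 \<Rightarrow> real \<Rightarrow> ratfun ^ 2 ^ 2" where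
  "Psi u0 u1 v w t =
     (transpose (vector [sharp_vec w, complement_column w]) :: ratfun ^ 2 ^ 2)
     ** (vector [vector [u0, 0], vector [0, rat_const (of_real t) * u1]] :: ratfun ^ 2 ^ 2)
     ** (vector [sharp_vec v, complement_column v] :: ratfun ^ 2 ^ 2)"

end

theory Submission
  imports Defs "HOL-Probability.Probability_Measure"
begin

text \<open>
  Everything is counted locally, at the points \<open>\<alpha>\<close> of the disk. For a matrix function of size
  \<open>2\<close> the McMillan multiplicity of the pole at \<open>\<alpha>\<close> is the largest pole order of a minor, that is,
  of the entries and of the determinant (\<open>pole_mult\<close>), and the degree of a function with all its
  poles in the disk is the sum of these multiplicities: a Blaschke--Potapov product that cancels the
  poles has a determinant with enough zeros by Cramer's rule (\<open>sum_pole_mult_le_bp_degree\<close>), and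
  conversely a suitable factor with a projection of rank one lowers a multiplicity by one
  (\<open>bp_degree_le\<close>). Adding a function that is analytic at \<open>\<alpha>\<close> changes no multiplicity. With
  \<open>f\<^sub>\<alpha>(t)\<close> for the multiplicity of \<open>\<Psi>\<^sub>t\<close> at \<open>\<alpha>\<close>, the degree of the antianalytic part of \<open>\<Psi>\<^sub>t\<close> is
  therefore \<open>\<Sum>\<^sub>\<alpha> f\<^sub>\<alpha>(t)\<close>, while the degree of the analytic part is obtained from the multiplicities
  in the disk of the reflected function \<open>\<Psi>\<^sub>t\<^sup>#\<close>.

  Two features of the family do the rest. The first is a symmetry (\<open>Psi_mult_sharp\<close>): on the circle
  the outer factors of \<open>\<Psi>\<^sub>t\<close> are unitary and \<open>u\<^sub>0\<close>, \<open>u\<^sub>1\<close> are unimodular, so the adjoint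
  of \<open>\<Psi>\<^sub>t\<close> is the inverse of \<open>\<Psi>\<^sub>s\<close> with \<open>s = 1 / t\<close>. Since inverting a matrix function adds the
  order of its determinant to the multiplicity (\<open>pole_mult_inverse\<close>) and the determinant of \<open>\<Psi>\<^sub>s\<close>
  is \<open>s u\<^sub>0 u\<^sub>1\<close>, the multiplicity of \<open>\<Psi>\<^sub>t\<^sup>#\<close> at \<open>\<alpha>\<close> is at most
  \<open>f\<^sub>\<alpha>(1/t) + ord\<^sub>\<alpha> u\<^sub>0 + ord\<^sub>\<alpha> u\<^sub>1\<close>. A badly approximable unimodular function has more poles than
  zeros in the disk (\<open>badly_approximable_index\<close>), so the orders of \<open>u\<^sub>0\<close> and of \<open>u\<^sub>1\<close> each sum to at
  most \<open>-1\<close>; this absorbs the constant \<open>2\<close>, and the term of the sum at \<open>t\<close> is at most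
  \<open>\<Sum>\<^sub>\<alpha> [f\<^sub>\<alpha>(1/t) - f\<^sub>\<alpha>(t)]\<^sub>+\<close>.

  The second feature is that \<open>\<Psi>\<^sub>t\<close> is affine in \<open>t\<close> and its determinant depends on \<open>t\<close> only through
  a constant factor. Any member is thus a combination of two others, so that
  \<open>f\<^sub>\<alpha>(s) \<le> max (f\<^sub>\<alpha>(t)) (f\<^sub>\<alpha>(t'))\<close> for all \<open>t \<noteq> t'\<close>, and hence \<open>f\<^sub>\<alpha>(1/t) > f\<^sub>\<alpha>(t)\<close> for at most one
  \<open>t\<close>. Moreover two members differ by a multiple of \<open>u\<^sub>1\<close> times an analytic matrix, so that
  \<open>f\<^sub>\<alpha>(1/t)\<close> exceeds \<open>f\<^sub>\<alpha>(t)\<close> only if it is at most the pole order of \<open>u\<^sub>1\<close> at \<open>\<alpha>\<close>. Consequently the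
  excesses at \<open>\<alpha>\<close>, summed over all \<open>t\<close>, are bounded by this pole order
  (\<open>sum_reciprocal_excess\<close>), and the pole orders of \<open>u\<^sub>1\<close> in the disk add up to the degree of its
  antianalytic part.
\<close>

(* The dollar sign is reserved for the entries of vectors and matrices. *)
no_notation fps_nth (infixl "$" 75)

section \<open>Orders and values of rational functions\<close>

lemma fract_lowest_terms:
  obtains a b where "r = to_fract a / to_fract b" "b \<noteq> (0 :: complex poly)" "coprime a b"
    "a = fst (quot_of_fract r)" "b = snd (quot_of_fract r)"
proof -
  have "r = to_fract (fst (quot_of_fract r)) / to_fract (snd (quot_of_fract r))"
    by (metis Fract_conv_to_fract Fract_quot_of_fract)
  thus ?thesis using that coprime_quot_of_fract snd_quot_of_fract_nonzero by blast
qed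

lemma to_fract_divide_eq_iff:
  assumes "b \<noteq> 0" "d \<noteq> (0::complex poly)"
  shows "to_fract a / to_fract b = to_fract c / to_fract d \<longleftrightarrow> a * d = c * b"
  using assms by (simp add: frac_eq_eq flip: to_fract_mult)

lemma coprime_no_common_root:
  assumes "coprime a b" "poly a z = 0"
  shows "poly b z \<noteq> (0::complex)"
proof
  assume "poly b z = 0"
  with assms(2) have "[:-z, 1:] dvd a" "[:-z, 1:] dvd b" by (simp_all add: poly_eq_0_iff_dvd)
  with assms(1) have "is_unit [:-z, 1:]" by (rule coprime_common_divisor)
  thus False by (auto simp: is_unit_poly_iff)
qed

definition rat_ord :: "complex \<Rightarrow> ratfun \<Rightarrow> int" where
  "rat_ord \<alpha> r = int (order \<alpha> (fst (quot_of_fract r))) - int (order \<alpha> (snd (quot_of_fract r)))"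

text \<open>
  Any representation as a quotient may be used, because passing to lowest terms cancels the same
  power of \<open>z - \<alpha>\<close> from both polynomials.
\<close>

lemma rat_ord_divide_poly:
  assumes "a \<noteq> 0" "b \<noteq> 0"
  shows "rat_ord \<alpha> (to_fract a / to_fract b) = int (order \<alpha> a) - int (order \<alpha> b)"
proof -
  define r where "r = to_fract a / to_fract b"
  obtain c d where r: "r = to_fract c / to_fract d" "d \<noteq> 0"
    "c = fst (quot_of_fract r)" "d = snd (quot_of_fract r)" by (rule fract_lowest_terms)
  have e: "c * b = a * d" using r assms unfolding r_def by (metis to_fract_divide_eq_iff)
  have "order \<alpha> (c * b) = order \<alpha> (a * d)" by (simp add: e)
  moreover have "c \<noteq> 0" using e assms r(2) by auto
  ultimately have "order \<alpha> c + order \<alpha> b = order \<alpha> a + order \<alpha> d"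
    using assms r(2) by (simp add: order_mult)
  thus ?thesis unfolding rat_ord_def r_def[symmetric] r(3)[symmetric] r(4)[symmetric] by linarith
qed

lemma rat_ord_to_fract: "a \<noteq> 0 \<Longrightarrow> rat_ord \<alpha> (to_fract a) = int (order \<alpha> a)"
  using rat_ord_divide_poly[of a 1] by simp

lemma rat_ord_mult:
  assumes "r \<noteq> 0" "s \<noteq> 0"
  shows "rat_ord \<alpha> (r * s) = rat_ord \<alpha> r + rat_ord \<alpha> s"
proof -
  obtain a b where r: "r = to_fract a / to_fract b" "b \<noteq> 0" by (rule fract_lowest_terms)
  obtain c d where s: "s = to_fract c / to_fract d" "d \<noteq> 0" by (rule fract_lowest_terms)
  have ne: "a \<noteq> 0" "c \<noteq> 0" using assms r s by auto
  have "r * s = to_fract (a * c) / to_fract (b * d)" by (simp add: r s)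
  moreover have "rat_ord \<alpha> (to_fract (a * c) / to_fract (b * d)) = int (order \<alpha> (a * c)) - int (order \<alpha> (b * d))"
    using ne r s by (intro rat_ord_divide_poly) auto
  ultimately show ?thesis using ne r s by (simp add: rat_ord_divide_poly order_mult)
qed

lemma rat_ord_1 [simp]: "rat_ord \<alpha> 1 = 0"
  by (simp add: rat_ord_def)

lemma rat_ord_inverse:
  assumes "r \<noteq> 0"
  shows "rat_ord \<alpha> (inverse r) = - rat_ord \<alpha> r"
  using rat_ord_mult[of r "inverse r" \<alpha>] assms by simp

lemma rat_ord_divide:
  assumes "r \<noteq> 0" "s \<noteq> 0"
  shows "rat_ord \<alpha> (r / s) = rat_ord \<alpha> r - rat_ord \<alpha> s"
  using assms by (simp add: divide_inverse rat_ord_mult rat_ord_inverse)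

lemma rat_ord_power: "r \<noteq> 0 \<Longrightarrow> rat_ord \<alpha> (r ^ n) = int n * rat_ord \<alpha> r"
  by (induction n) (simp_all add: rat_ord_mult algebra_simps)

lemma rat_ord_power_int: "r \<noteq> 0 \<Longrightarrow> rat_ord \<alpha> (r powi k) = k * rat_ord \<alpha> r"
  by (auto simp: power_int_def rat_ord_power rat_ord_inverse)

lemma rat_ord_prod:
  assumes "\<And>i. i \<in> I \<Longrightarrow> f i \<noteq> 0"
  shows "rat_ord \<alpha> (\<Prod>i\<in>I. f i) = (\<Sum>i\<in>I. rat_ord \<alpha> (f i))"
  using assms by (induction I rule: infinite_finite_induct) (simp_all add: rat_ord_mult)

lemma rat_const_simps [simp]:
  "rat_const 0 = 0" "rat_const 1 = 1" "rat_const a = 0 \<longleftrightarrow> a = 0"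
  "rat_const a = rat_const b \<longleftrightarrow> a = b"
  by (simp_all add: rat_const_def one_pCons[symmetric])

lemma rat_const_hom:
  "rat_const (a + b) = rat_const a + rat_const b" "rat_const (a - b) = rat_const a - rat_const b"
  "rat_const (a * b) = rat_const a * rat_const b" "rat_const (- a) = - rat_const a"
  by (simp_all add: rat_const_def flip: to_fract_add to_fract_diff to_fract_mult to_fract_uminus)

lemma rat_const_divide: "rat_const (a / b) = rat_const a / rat_const b"
proof (cases "b = 0")
  case False
  hence "rat_const (a / b) * rat_const b = rat_const a" by (simp flip: rat_const_hom)
  thus ?thesis using False by (simp add: field_simps)
qed simp

lemma rat_const_sum: "rat_const (\<Sum>i\<in>I. f i) = (\<Sum>i\<in>I. rat_const (f i))"
  by (induction I rule: infinite_finite_induct) (simp_all add: rat_const_hom)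

lemma rat_ord_const: "c \<noteq> 0 \<Longrightarrow> rat_ord \<alpha> (rat_const c) = 0"
  by (auto simp: rat_const_def rat_ord_to_fract intro!: order_0I)

lemma rat_linear: "rat_z - rat_const \<beta> = to_fract [:-\<beta>, 1:]"
  by (simp add: rat_z_def rat_const_def flip: to_fract_diff)

lemma rat_linear_nonzero [simp]: "rat_z - rat_const \<beta> \<noteq> 0" "rat_const \<beta> - rat_z \<noteq> 0" "rat_z \<noteq> 0"
  using rat_linear[of \<beta>] by (auto simp: rat_z_def)

lemma rat_ord_linear: "rat_ord \<alpha> (rat_z - rat_const \<beta>) = (if \<alpha> = \<beta> then 1 else 0)"
  using order_power_n_n[of \<beta> 1] by (auto simp: rat_linear rat_ord_to_fract intro!: order_0I)

text \<open>
  The valuation ideals of the local ring at \<open>\<alpha>\<close>; the function \<open>0\<close>, to which no order is attached,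
  belongs to all of them.
\<close>

definition ord_ge :: "complex \<Rightarrow> int \<Rightarrow> ratfun \<Rightarrow> bool" where
  "ord_ge \<alpha> k r \<longleftrightarrow> r = 0 \<or> k \<le> rat_ord \<alpha> r"

lemma ord_ge_0 [simp]: "ord_ge \<alpha> k 0"
  by (simp add: ord_ge_def)

lemma ord_ge_mono: "ord_ge \<alpha> k r \<Longrightarrow> l \<le> k \<Longrightarrow> ord_ge \<alpha> l r"
  by (auto simp: ord_ge_def)

lemma ord_ge_mult: "ord_ge \<alpha> k r \<Longrightarrow> ord_ge \<alpha> l s \<Longrightarrow> ord_ge \<alpha> (k + l) (r * s)"
  by (cases "r = 0"; cases "s = 0") (auto simp: ord_ge_def rat_ord_mult)

lemma ord_ge_mult_iff: "s \<noteq> 0 \<Longrightarrow> ord_ge \<alpha> k (r * s) \<longleftrightarrow> ord_ge \<alpha> (k - rat_ord \<alpha> s) r"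
  by (cases "r = 0") (auto simp: ord_ge_def rat_ord_mult)

lemma ord_ge_const: "ord_ge \<alpha> 0 (rat_const c)"
  by (cases "c = 0") (auto simp: ord_ge_def rat_ord_const)

lemma ord_ge_cmult: "ord_ge \<alpha> k r \<Longrightarrow> ord_ge \<alpha> k (rat_const c * r)"
  using ord_ge_mult[OF ord_ge_const, of \<alpha> k r c] by simp

lemma ord_ge_uminus [simp]: "ord_ge \<alpha> k (- r) \<longleftrightarrow> ord_ge \<alpha> k r"
proof -
  have "ord_ge \<alpha> k (- r)" if "ord_ge \<alpha> k r" for r
    using ord_ge_cmult[OF that, of "-1"] by (simp add: rat_const_hom)
  from this[of r] this[of "-r"] show ?thesis by auto
qed

lemma ord_ge_add:
  assumes "ord_ge \<alpha> k r" "ord_ge \<alpha> k s"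
  shows "ord_ge \<alpha> k (r + s)"
proof (cases "r = 0 \<or> s = 0 \<or> r + s = 0")
  case False
  obtain a b where r: "r = to_fract a / to_fract b" "b \<noteq> 0" by (rule fract_lowest_terms)
  obtain c d where s: "s = to_fract c / to_fract d" "d \<noteq> 0" by (rule fract_lowest_terms)
  have ne: "a \<noteq> 0" "c \<noteq> 0" using False r s by auto
  have eq: "r + s = to_fract (a * d + c * b) / to_fract (b * d)"
    using r(2) s(2) by (simp add: r(1) s(1) field_simps)
  have ne': "a * d + c * b \<noteq> 0"
  proof
    assume "a * d + c * b = 0"
    with eq have "r + s = 0" by (simp del: to_fract_add)
    with False show False by blast
  qed
  define m where "m = min (order \<alpha> (a * d)) (order \<alpha> (c * b))"
  have "[:-\<alpha>, 1:] ^ m dvd a * d" "[:-\<alpha>, 1:] ^ m dvd c * b"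
    by (auto simp: order_divides m_def)
  hence "[:-\<alpha>, 1:] ^ m dvd a * d + c * b" by (rule dvd_add)
  hence "m \<le> order \<alpha> (a * d + c * b)" using ne' order_divides by blast
  moreover have "rat_ord \<alpha> (r + s) = int (order \<alpha> (a * d + c * b)) - int (order \<alpha> (b * d))"
    unfolding eq using ne' r(2) s(2) by (intro rat_ord_divide_poly) auto
  ultimately show ?thesis using assms ne r s False unfolding m_def
    by (auto simp: ord_ge_def rat_ord_divide_poly order_mult)
qed (use assms in \<open>auto\<close>)

lemma ord_ge_diff: "ord_ge \<alpha> k r \<Longrightarrow> ord_ge \<alpha> k s \<Longrightarrow> ord_ge \<alpha> k (r - s)"
  using ord_ge_add[of \<alpha> k r "-s"] by simp

lemma ord_ge_sum: "(\<And>i. i \<in> I \<Longrightarrow> ord_ge \<alpha> k (f i)) \<Longrightarrow> ord_ge \<alpha> k (\<Sum>i\<in>I. f i)"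
  by (induction I rule: infinite_finite_induct) (auto intro: ord_ge_add)

lemma ord_ge_exists: "\<exists>n. ord_ge \<alpha> (- int n) r"
  by (rule exI[of _ "nat (- rat_ord \<alpha> r)"]) (auto simp: ord_ge_def)

abbreviation regular :: "complex \<Rightarrow> ratfun \<Rightarrow> bool" where
  "regular \<alpha> \<equiv> ord_ge \<alpha> 0"

lemma regular_mult: "regular \<alpha> r \<Longrightarrow> regular \<alpha> s \<Longrightarrow> regular \<alpha> (r * s)"
  using ord_ge_mult[of \<alpha> 0 r 0 s] by simp

lemma regular_1 [simp]: "regular \<alpha> 1"
  by (simp add: ord_ge_def)

lemma regular_prod: "(\<And>i. i \<in> I \<Longrightarrow> regular \<alpha> (f i)) \<Longrightarrow> regular \<alpha> (\<Prod>i\<in>I. f i)"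
  by (induction I rule: infinite_finite_induct) (auto intro: regular_mult)

lemma regular_iff_denominator: "regular \<alpha> r \<longleftrightarrow> poly (snd (quot_of_fract r)) \<alpha> \<noteq> 0"
proof -
  obtain a b where r: "r = to_fract a / to_fract b" "b \<noteq> 0" "coprime a b"
    "a = fst (quot_of_fract r)" "b = snd (quot_of_fract r)" by (rule fract_lowest_terms)
  have "\<not> (poly a \<alpha> = 0 \<and> poly b \<alpha> = 0)" using coprime_no_common_root[OF r(3)] by blast
  moreover have "b = 1" if "a = 0"
  proof -
    have "r = 0" using that r(1) by simp
    thus ?thesis using r(5) by simp
  qed
  moreover have "a = 0 \<longleftrightarrow> r = 0" using r(1,2) by auto
  ultimately show ?thesis using r(2) order_0I[of b \<alpha>] order_0I[of a \<alpha>] order_eq_0_iff[of b \<alpha>] order_eq_0_iff[of a \<alpha>]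
    by (auto simp: ord_ge_def rat_ord_def r(4)[symmetric] r(5)[symmetric])
qed

lemma regular_divide_poly: "poly b \<alpha> \<noteq> 0 \<Longrightarrow> regular \<alpha> (to_fract a / to_fract b)"
  by (cases "a = 0 \<or> b = 0") (auto simp: ord_ge_def rat_ord_divide_poly order_0I)

lemma regularE:
  assumes "regular \<alpha> r"
  obtains a b where "r = to_fract a / to_fract b" "poly b \<alpha> \<noteq> 0"
  by (rule fract_lowest_terms[of r]) (use assms that in \<open>metis regular_iff_denominator\<close>)

lemma regular_rat_z [simp]: "regular \<alpha> rat_z"
  using regular_divide_poly[of 1 \<alpha> "[:0,1:]"] by (simp add: rat_z_def)

lemma finite_nonregular: "finite {\<alpha>. \<not> regular \<alpha> r}"
  unfolding regular_iff_denominator by (simp add: poly_roots_finite)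

lemma rat_eval_add: "regular z r \<Longrightarrow> regular z s \<Longrightarrow> rat_eval (r + s) z = rat_eval r z + rat_eval s z"
proof (elim regularE)
  fix a b c d
  assume r: "r = to_fract a / to_fract b" "poly b z \<noteq> 0"
    and s: "s = to_fract c / to_fract d" "poly d z \<noteq> 0"
  have "b \<noteq> 0" "d \<noteq> 0" using r s by auto
  hence "r + s = to_fract (a * d + c * b) / to_fract (b * d)"
    by (simp add: r(1) s(1) add_frac_eq)
  moreover have "rat_eval (to_fract (a * d + c * b) / to_fract (b * d)) z
      = poly (a * d + c * b) z / poly (b * d) z"
    by (rule rat_eval_divide) (use r s in simp)
  ultimately show ?thesis using r s by (simp add: rat_eval_divide add_frac_eq)
qed

lemma rat_eval_mult: "regular z r \<Longrightarrow> regular z s \<Longrightarrow> rat_eval (r * s) z = rat_eval r z * rat_eval s z"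
proof (elim regularE)
  fix a b c d
  assume r: "r = to_fract a / to_fract b" "poly b z \<noteq> 0"
    and s: "s = to_fract c / to_fract d" "poly d z \<noteq> 0"
  have "r * s = to_fract (a * c) / to_fract (b * d)" by (simp add: r(1) s(1))
  moreover have "rat_eval (to_fract (a * c) / to_fract (b * d)) z = poly (a * c) z / poly (b * d) z"
    by (rule rat_eval_divide) (use r s in simp)
  ultimately show ?thesis using r s by (simp add: rat_eval_divide)
qed

lemma rat_eval_poly: "rat_eval (to_fract a) z = poly a z"
  using rat_eval_divide[of 1 z a] by simp

lemma rat_eval_simps [simp]:
  "rat_eval 0 z = 0" "rat_eval 1 z = 1" "rat_eval (rat_const c) z = c" "rat_eval rat_z z = z"
  using rat_eval_poly[of 0 z] rat_eval_poly[of 1 z]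
  by (simp_all add: rat_const_def rat_z_def rat_eval_poly)

lemma rat_eval_uminus: "regular z r \<Longrightarrow> rat_eval (- r) z = - rat_eval r z"
  using rat_eval_add[of z r "-r"] by (simp add: add_eq_0_iff)

lemma rat_eval_diff: "regular z r \<Longrightarrow> regular z s \<Longrightarrow> rat_eval (r - s) z = rat_eval r z - rat_eval s z"
  using rat_eval_add[of z r "-s"] rat_eval_uminus[of z s] by simp

lemma ord_ge_1_iff: "ord_ge \<alpha> 1 r \<longleftrightarrow> regular \<alpha> r \<and> rat_eval r \<alpha> = 0"
proof (cases "regular \<alpha> r")
  case True
  then obtain a b where r: "r = to_fract a / to_fract b" "poly b \<alpha> \<noteq> 0" by (rule regularE)
  have "order \<alpha> b = 0" using r by (simp add: order_0I)
  show ?thesis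
  proof (cases "a = 0")
    case False
    hence "rat_ord \<alpha> r = int (order \<alpha> a)" "r \<noteq> 0"
      using r \<open>order \<alpha> b = 0\<close> rat_ord_divide_poly[of a b \<alpha>] by (cases "b = 0"; force)+
    moreover have "rat_eval r \<alpha> = poly a \<alpha> / poly b \<alpha>" using r by (simp add: rat_eval_divide)
    ultimately show ?thesis using False r order_eq_0_iff[of a \<alpha>] True by (auto simp: ord_ge_def)
  qed (use r in auto)
qed (auto dest: ord_ge_mono[of \<alpha> 1 r 0])

lemma rat_ord_eq_0_iff:
  assumes "r \<noteq> 0"
  shows "rat_ord \<alpha> r = 0 \<longleftrightarrow> regular \<alpha> r \<and> rat_eval r \<alpha> \<noteq> 0"
  using assms ord_ge_1_iff[of \<alpha> r] by (auto simp: ord_ge_def)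

lemma rat_eval_inverse:
  assumes "regular z r" "rat_eval r z \<noteq> 0"
  shows "regular z (inverse r)" "rat_eval (inverse r) z = inverse (rat_eval r z)"
proof -
  have r: "r \<noteq> 0" using assms by auto
  hence 0: "rat_ord z r = 0" using assms rat_ord_eq_0_iff by blast
  with r show *: "regular z (inverse r)" by (simp add: ord_ge_def rat_ord_inverse)
  show "rat_eval (inverse r) z = inverse (rat_eval r z)"
    using rat_eval_mult[OF assms(1) *] r assms(2) by (simp add: field_simps)
qed

lemma rat_eval_divide_regular:
  assumes "regular z s" "regular z r" "rat_eval r z \<noteq> 0"
  shows "regular z (s / r)" "rat_eval (s / r) z = rat_eval s z / rat_eval r z"
  using rat_eval_inverse[OF assms(2,3)] assms(1)
  by (simp_all add: divide_inverse regular_mult rat_eval_mult)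

lemma rat_eval_power_int:
  assumes "regular z r" "rat_eval r z \<noteq> 0"
  shows "rat_eval (r powi k) z = rat_eval r z powi k" "regular z (r powi k)"
proof -
  have *: "rat_eval (s ^ n) z = rat_eval s z ^ n \<and> regular z (s ^ n)" if "regular z s" for s n
    using that by (induction n) (simp_all add: rat_eval_mult regular_mult)
  show "rat_eval (r powi k) z = rat_eval r z powi k" "regular z (r powi k)"
    using *[of r] *[of "inverse r"] assms rat_eval_inverse[OF assms]
    by (auto simp: power_int_def)
qed

lemma rat_eval_prod:
  assumes "\<And>i. i \<in> I \<Longrightarrow> regular z (f i)"
  shows "rat_eval (\<Prod>i\<in>I. f i) z = (\<Prod>i\<in>I. rat_eval (f i) z)"
  using assms by (induction I rule: infinite_finite_induct) (simp_all add: rat_eval_mult regular_prod)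

lemma rat_eval_analytic:
  assumes "\<And>z. z \<in> U \<Longrightarrow> regular z r"
  shows "rat_eval r analytic_on U"
proof -
  have "(\<lambda>z. poly p z) analytic_on U" for p :: "complex poly"
    by (induction p) (auto intro!: analytic_intros)
  hence "(\<lambda>z. poly (fst (quot_of_fract r)) z / poly (snd (quot_of_fract r)) z) analytic_on U"
    using assms by (intro analytic_on_divide) (auto simp: regular_iff_denominator)
  thus ?thesis by (simp add: rat_eval_def[abs_def])
qed

lemma rat_eval_measurable [measurable]: "rat_eval r \<in> borel_measurable borel"
proof -
  have "(\<lambda>z. poly p z) \<in> borel_measurable borel" for p :: "complex poly"
    by (intro borel_measurable_continuous_onI continuous_intros)
  thus ?thesis unfolding rat_eval_def[abs_def] by (intro borel_measurable_divide)
qed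

section \<open>Identities on the circle, and the two reflections\<close>

text \<open>
  The circle up to finite sets. Values of sums, products and reflections are the expected ones away
  from finitely many poles, and a rational function is determined by its values on an infinite set,
  so identities between rational functions may be checked along this filter.
\<close>

definition circle_cofinite :: "complex filter" where
  "circle_cofinite = inf cofinite (principal (sphere 0 1))"

lemma eventually_circle_cofinite:
  "eventually P circle_cofinite \<longleftrightarrow> finite {z. norm z = 1 \<and> \<not> P z}"
  by (auto simp: circle_cofinite_def eventually_inf_principal eventually_cofinite)

lemma infinite_circle: "infinite {z::complex. norm z = 1}"
proof
  assume "finite {z::complex. norm z = 1}"
  hence "finite (Re ` {z::complex. norm z = 1})" by (rule finite_imageI)
  moreover have "{0..1} \<subseteq> Re ` {z::complex. norm z = 1}"
  proof
    fix x :: real assume "x \<in> {0..1}"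
    hence "norm (Complex x (sqrt (1 - x\<^sup>2))) = 1" by (simp add: cmod_def power_le_one)
    thus "x \<in> Re ` {z. norm z = 1}" by (intro image_eqI[of _ _ "Complex x (sqrt (1 - x\<^sup>2))"]) auto
  qed
  ultimately have "finite {0..1::real}" by (rule rev_finite_subset)
  thus False using infinite_Icc[of 0 "1::real"] by simp
qed

lemma eventually_circle_norm: "\<forall>\<^sub>F z in circle_cofinite. norm z = 1"
  by (simp add: eventually_circle_cofinite)

lemma eventually_circle_regular: "\<forall>\<^sub>F z in circle_cofinite. regular z r"
  unfolding eventually_circle_cofinite by (rule finite_subset[OF _ finite_nonregular[of r]]) auto

lemma eventually_circle_poly: "p \<noteq> 0 \<Longrightarrow> \<forall>\<^sub>F z in circle_cofinite. poly p z \<noteq> 0"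
  unfolding eventually_circle_cofinite by (rule finite_subset[OF _ poly_roots_finite[of p]]) auto

lemma finite_rat_zeros: "r \<noteq> 0 \<Longrightarrow> finite {z. rat_eval r z = 0}"
proof -
  assume "r \<noteq> 0"
  have "{z. rat_eval r z = 0} \<subseteq> {z. poly (fst (quot_of_fract r)) z = 0} \<union> {z. poly (snd (quot_of_fract r)) z = 0}"
    by (auto simp: rat_eval_def)
  moreover have "finite ({z. poly (fst (quot_of_fract r)) z = 0} \<union> {z. poly (snd (quot_of_fract r)) z = 0})"
    using \<open>r \<noteq> 0\<close> by (auto intro!: poly_roots_finite)
  ultimately show ?thesis by (rule finite_subset)
qed

lemma ratfun_eqI_circle:
  assumes "\<forall>\<^sub>F z in circle_cofinite. rat_eval r z = rat_eval s z"
  shows "r = s"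
proof (rule ccontr)
  assume "r \<noteq> s"
  hence "finite {z. rat_eval (r - s) z = 0}" by (intro finite_rat_zeros) auto
  moreover have "\<forall>\<^sub>F z in circle_cofinite. rat_eval (r - s) z = 0"
    using assms eventually_circle_regular[of r] eventually_circle_regular[of s]
    by eventually_elim (simp add: rat_eval_diff)
  ultimately have "finite ({z. rat_eval (r - s) z = 0} \<union> {z. norm z = 1 \<and> rat_eval (r - s) z \<noteq> 0})"
    by (simp add: eventually_circle_cofinite)
  hence "finite {z::complex. norm z = 1}" by (rule finite_subset[rotated]) auto
  thus False using infinite_circle by blast
qed

lemma inverse_on_circle:
  assumes "norm z = 1"
  shows "1 / z = cnj z" "1 / cnj z = z"
proof -
  have "z * cnj z = 1" "z \<noteq> 0" using assms complex_norm_square[of z] by auto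
  thus "1 / z = cnj z" "1 / cnj z = z" by (auto simp: field_simps)
qed

lemma regular_subst_divide:
  assumes "z \<noteq> 0" "poly q (1 / z) \<noteq> 0"
  shows "regular z (rat_subst p (1 / rat_z) / rat_subst q (1 / rat_z))"
proof -
  obtain a b where ab: "rat_subst p (1 / rat_z) = to_fract a / to_fract b" "poly b z \<noteq> 0"
    "poly a z / poly b z = poly p (1 / z)" using rat_subst_inverse_eq assms(1) by blast
  obtain c d where cd: "rat_subst q (1 / rat_z) = to_fract c / to_fract d" "poly d z \<noteq> 0"
    "poly c z / poly d z = poly q (1 / z)" using rat_subst_inverse_eq assms(1) by blast
  have "poly (b * c) z \<noteq> 0" using ab cd assms by auto
  moreover have "rat_subst p (1 / rat_z) / rat_subst q (1 / rat_z) = to_fract (a * d) / to_fract (b * c)"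
    by (simp add: ab(1) cd(1))
  ultimately show ?thesis using regular_divide_poly by metis
qed

lemma regular_flat: "z \<noteq> 0 \<Longrightarrow> regular (1 / z) r \<Longrightarrow> regular z (rat_flat r)"
  unfolding rat_flat_def by (intro regular_subst_divide) (auto simp: regular_iff_denominator)

lemma regular_sharp: "z \<noteq> 0 \<Longrightarrow> regular (1 / cnj z) r \<Longrightarrow> regular z (rat_sharp r)"
  unfolding rat_sharp_def by (intro regular_subst_divide) (auto simp: regular_iff_denominator)

lemma rat_eval_flat_regular: "z \<noteq> 0 \<Longrightarrow> regular (1 / z) r \<Longrightarrow> rat_eval (rat_flat r) z = rat_eval r (1 / z)"
  using rat_eval_flat by (simp add: regular_iff_denominator)

lemma rat_eval_sharp_regular: "z \<noteq> 0 \<Longrightarrow> regular (1 / cnj z) r \<Longrightarrow> rat_eval (rat_sharp r) z = cnj (rat_eval r (1 / cnj z))"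
  using rat_eval_sharp by (simp add: regular_iff_denominator)

lemma rat_sharp_circle:
  assumes "norm z = 1" "regular z r"
  shows "regular z (rat_sharp r)" "rat_eval (rat_sharp r) z = cnj (rat_eval r z)"
  using assms regular_sharp[of z r] rat_eval_sharp_regular[of z r] inverse_on_circle[of z] by fastforce+

lemma eventually_rat_eval_sharp:
  "\<forall>\<^sub>F z in circle_cofinite. regular z r \<and> regular z (rat_sharp r) \<and> rat_eval (rat_sharp r) z = cnj (rat_eval r z)"
  using eventually_circle_norm eventually_circle_regular[of r]
  by eventually_elim (simp add: rat_sharp_circle)

lemma rat_sharp_add: "rat_sharp (r + s) = rat_sharp r + rat_sharp s"
  by (rule ratfun_eqI_circle, use eventually_rat_eval_sharp[of r] eventually_rat_eval_sharp[of s]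
    eventually_rat_eval_sharp[of "r + s"] in eventually_elim) (simp add: rat_eval_add)

lemma rat_sharp_mult: "rat_sharp (r * s) = rat_sharp r * rat_sharp s"
  by (rule ratfun_eqI_circle, use eventually_rat_eval_sharp[of r] eventually_rat_eval_sharp[of s]
    eventually_rat_eval_sharp[of "r * s"] in eventually_elim) (simp add: rat_eval_mult)

lemma rat_sharp_uminus: "rat_sharp (- r) = - rat_sharp r"
  by (rule ratfun_eqI_circle, use eventually_rat_eval_sharp[of r]
    eventually_rat_eval_sharp[of "- r"] in eventually_elim) (simp add: rat_eval_uminus)

lemma rat_sharp_const: "rat_sharp (rat_const c) = rat_const (cnj c)"
  by (rule ratfun_eqI_circle, use eventually_rat_eval_sharp[of "rat_const c"] in eventually_elim) simp

lemma rat_sharp_sharp [simp]: "rat_sharp (rat_sharp r) = r"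
  by (rule ratfun_eqI_circle, use eventually_rat_eval_sharp[of r]
    eventually_rat_eval_sharp[of "rat_sharp r"] in eventually_elim) simp

lemma rat_flat_circle:
  assumes "norm z = 1" "regular (cnj z) r"
  shows "regular z (rat_flat r)" "rat_eval (rat_flat r) z = rat_eval r (cnj z)"
  using assms regular_flat[of z r] rat_eval_flat_regular[of z r] inverse_on_circle[of z] by fastforce+

lemma eventually_circle_cnj:
  assumes "eventually P circle_cofinite"
  shows "\<forall>\<^sub>F z in circle_cofinite. P (cnj z)"
proof -
  have "{z. norm z = 1 \<and> \<not> P (cnj z)} \<subseteq> cnj ` {z. norm z = 1 \<and> \<not> P z}"
    by (auto intro!: image_eqI[of _ _ "cnj _"])
  thus ?thesis using assms unfolding eventually_circle_cofinite by (auto intro: finite_subset)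
qed

lemma eventually_rat_eval_flat:
  "\<forall>\<^sub>F z in circle_cofinite. regular (cnj z) r \<and> regular z (rat_flat r) \<and> rat_eval (rat_flat r) z = rat_eval r (cnj z)"
  using eventually_circle_norm eventually_circle_cnj[OF eventually_circle_regular[of r]]
  by eventually_elim (simp add: rat_flat_circle)

lemma rat_flat_add: "rat_flat (r + s) = rat_flat r + rat_flat s"
  by (rule ratfun_eqI_circle, use eventually_rat_eval_flat[of r] eventually_rat_eval_flat[of s]
    eventually_rat_eval_flat[of "r + s"] in eventually_elim) (simp add: rat_eval_add)

lemma rat_flat_mult: "rat_flat (r * s) = rat_flat r * rat_flat s"
  by (rule ratfun_eqI_circle, use eventually_rat_eval_flat[of r] eventually_rat_eval_flat[of s]
    eventually_rat_eval_flat[of "r * s"] in eventually_elim) (simp add: rat_eval_mult)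

lemma rat_flat_uminus: "rat_flat (- r) = - rat_flat r"
  by (rule ratfun_eqI_circle, use eventually_rat_eval_flat[of r]
    eventually_rat_eval_flat[of "- r"] in eventually_elim) (simp add: rat_eval_uminus)

text \<open>
  The reversed coefficient sequence gives \<open>p(1/z) = z\<^sup>-\<^sup>d reflect_poly p z\<close> with \<open>d = degree p\<close>; this
  form shows the behaviour of the reflected function at \<open>0\<close>, that is, of the given one at infinity.
\<close>

lemma rat_flat_divide_poly:
  assumes "b \<noteq> 0" "degree a \<le> degree b"
  shows "rat_flat (to_fract a / to_fract b)
    = to_fract (reflect_poly a * [:0, 1:] ^ (degree b - degree a)) / to_fract (reflect_poly b)"
    (is "_ = to_fract ?n / to_fract ?d")
proof (rule ratfun_eqI_circle)
  show "\<forall>\<^sub>F z in circle_cofinite. rat_eval (rat_flat (to_fract a / to_fract b)) z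
      = rat_eval (to_fract ?n / to_fract ?d) z"
    using eventually_rat_eval_flat[of "to_fract a / to_fract b"] eventually_circle_norm
      eventually_circle_cnj[OF eventually_circle_poly[OF assms(1)]]
  proof eventually_elim
    case (elim z)
    have z: "z \<noteq> 0" "inverse z = cnj z" using elim inverse_on_circle[of z] by (auto simp: inverse_eq_divide)
    have "poly ?d z \<noteq> 0" using elim z by (simp add: poly_reflect_poly_nz)
    hence "rat_eval (to_fract ?n / to_fract ?d) z = poly ?n z / poly ?d z" by (rule rat_eval_divide)
    also have "\<dots> = (z ^ degree a * z ^ (degree b - degree a)) * poly a (cnj z) / (z ^ degree b * poly b (cnj z))"
      using z by (simp add: poly_reflect_poly_nz)
    also have "\<dots> = poly a (cnj z) / poly b (cnj z)"
      using z assms(2) by (simp flip: power_add)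
    also have "\<dots> = rat_eval (to_fract a / to_fract b) (cnj z)"
      using elim by (simp add: rat_eval_divide)
    finally show ?case using elim by simp
  qed
qed

lemma order_map_poly_cnj: "p \<noteq> 0 \<Longrightarrow> order (cnj \<alpha>) (map_poly cnj p) = order \<alpha> p"
proof -
  assume "p \<noteq> 0"
  obtain q where q: "p = [:-\<alpha>, 1:] ^ order \<alpha> p * q" "\<not> [:-\<alpha>, 1:] dvd q"
    using order_decomp[OF \<open>p \<noteq> 0\<close>] by blast
  define n where "n = order \<alpha> p"
  have "poly (map_poly cnj p) = poly ([:-cnj \<alpha>, 1:] ^ n * map_poly cnj q)"
    by (rule ext) (subst q(1), simp add: n_def)
  hence "map_poly cnj p = [:-cnj \<alpha>, 1:] ^ n * map_poly cnj q" by (simp only: poly_eq_poly_eq_iff)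
  moreover have "poly (map_poly cnj q) (cnj \<alpha>) \<noteq> 0" using q(2) by (simp add: poly_eq_0_iff_dvd)
  moreover from this have "map_poly cnj q \<noteq> 0" by (metis poly_0)
  ultimately show ?thesis by (simp add: order_mult order_power_n_n order_0I n_def)
qed

text \<open>
  The two reflections differ by conjugating the coefficients, so their orders agree at conjugate
  points. Degrees of analytic parts are defined through the first reflection, whereas the symmetry of
  the family is one of the second.
\<close>

lemma ord_ge_flat_iff_sharp: "ord_ge (cnj \<alpha>) k (rat_flat r) \<longleftrightarrow> ord_ge \<alpha> k (rat_sharp r)"
proof -
  obtain a b where s: "rat_sharp r = to_fract a / to_fract b" "b \<noteq> 0" by (rule fract_lowest_terms)
  have b': "map_poly cnj b \<noteq> 0" using s(2) by (simp add: map_poly_eq_0_iff)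
  have "rat_flat r = to_fract (map_poly cnj a) / to_fract (map_poly cnj b)"
  proof (rule ratfun_eqI_circle)
    show "\<forall>\<^sub>F z in circle_cofinite. rat_eval (rat_flat r) z
        = rat_eval (to_fract (map_poly cnj a) / to_fract (map_poly cnj b)) z"
      using eventually_rat_eval_flat[of r] eventually_circle_cnj[OF eventually_rat_eval_sharp[of r]]
        eventually_circle_poly[OF b']
    proof eventually_elim
      case (elim z)
      have "rat_eval (rat_flat r) z = cnj (rat_eval (rat_sharp r) (cnj z))" using elim by simp
      also have "\<dots> = cnj (poly a (cnj z) / poly b (cnj z))"
        unfolding s(1) by (subst rat_eval_divide) (use elim in auto)
      also have "\<dots> = rat_eval (to_fract (map_poly cnj a) / to_fract (map_poly cnj b)) z"
        by (subst rat_eval_divide) (use elim in auto)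
      finally show ?case .
    qed
  qed
  thus ?thesis using s b' by (cases "a = 0") (auto simp: ord_ge_def rat_ord_divide_poly order_map_poly_cnj map_poly_eq_0_iff)
qed

section \<open>Pole multiplicities of matrix functions\<close>

lemma rat_const_of_int: "rat_const (of_int n) = of_int n"
  by (induction n rule: int_induct[of _ 0]) (simp_all add: rat_const_hom)

lemma regular_of_int [simp]: "regular \<alpha> (of_int n)"
  by (metis rat_const_of_int ord_ge_const)

lemma regular_det:
  fixes M :: "ratfun ^ 'n ^ 'n"
  assumes "\<And>i j. regular \<alpha> (M $ i $ j)"
  shows "regular \<alpha> (det M)"
  unfolding det_def by (intro ord_ge_sum regular_mult regular_prod assms regular_of_int)

lemma ord_ge_matrix_mult:
  fixes M :: "ratfun ^ 'n ^ 'm" and N :: "ratfun ^ 'k ^ 'n"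
  assumes "\<And>i j. ord_ge \<alpha> k (M $ i $ j)" "\<And>i j. ord_ge \<alpha> l (N $ i $ j)"
  shows "ord_ge \<alpha> (k + l) ((M ** N) $ i $ j)"
  unfolding matrix_matrix_mult_def by (simp, intro ord_ge_sum ord_ge_mult assms)

text \<open>
  For size one or two every minor is an entry or the determinant, so that \<open>pole_mult\<close> below is the
  McMillan multiplicity of the pole at \<open>\<alpha>\<close> for these sizes. The determinant matters: for
  \<open>diag(1/z, 1/z)\<close> the entries have a simple pole, but the multiplicity is \<open>2\<close>.
\<close>

definition mat_ord_ge :: "complex \<Rightarrow> int \<Rightarrow> ratfun ^ 'n ^ 'n \<Rightarrow> bool" where
  "mat_ord_ge \<alpha> k \<Phi> \<longleftrightarrow> (\<forall>i j. ord_ge \<alpha> k (\<Phi> $ i $ j)) \<and> ord_ge \<alpha> k (det \<Phi>)"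

definition pole_mult :: "complex \<Rightarrow> ratfun ^ 'n ^ 'n \<Rightarrow> nat" where
  "pole_mult \<alpha> \<Phi> = (LEAST n. mat_ord_ge \<alpha> (- int n) \<Phi>)"

lemma mat_ord_ge_mono: "mat_ord_ge \<alpha> k \<Phi> \<Longrightarrow> l \<le> k \<Longrightarrow> mat_ord_ge \<alpha> l \<Phi>"
  by (auto simp: mat_ord_ge_def intro: ord_ge_mono)

lemma mat_ord_ge_exists:
  fixes \<Phi> :: "ratfun ^ 'n ^ 'n"
  shows "\<exists>n. mat_ord_ge \<alpha> (- int n) \<Phi>"
proof -
  define f where "f r = (SOME n. ord_ge \<alpha> (- int n) r)" for r
  have f: "ord_ge \<alpha> (- int (f r)) r" for r
    unfolding f_def using ord_ge_exists by (rule someI_ex)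
  define N where "N = f (det \<Phi>) + (\<Sum>i\<in>UNIV. \<Sum>j\<in>UNIV. f (\<Phi> $ i $ j))"
  have "f (\<Phi> $ i $ j) \<le> N" for i j
  proof -
    have "f (\<Phi> $ i $ j) \<le> (\<Sum>j\<in>UNIV. f (\<Phi> $ i $ j))" by (rule member_le_sum) auto
    also have "\<dots> \<le> (\<Sum>i\<in>UNIV. \<Sum>j\<in>UNIV. f (\<Phi> $ i $ j))"
      by (rule member_le_sum[where f = "\<lambda>i. \<Sum>j\<in>UNIV. f (\<Phi> $ i $ j)"]) auto
    finally show ?thesis by (simp add: N_def)
  qed
  hence "mat_ord_ge \<alpha> (- int N) \<Phi>" unfolding mat_ord_ge_def
    by (auto intro!: ord_ge_mono[OF f]) (simp add: N_def)
  thus ?thesis by blast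
qed

lemma pole_mult_le_iff: "pole_mult \<alpha> \<Phi> \<le> n \<longleftrightarrow> mat_ord_ge \<alpha> (- int n) \<Phi>"
proof
  have "mat_ord_ge \<alpha> (- int (pole_mult \<alpha> \<Phi>)) \<Phi>"
    unfolding pole_mult_def using mat_ord_ge_exists by (rule LeastI_ex)
  thus "mat_ord_ge \<alpha> (- int n) \<Phi>" if "pole_mult \<alpha> \<Phi> \<le> n"
    using that by (auto intro: mat_ord_ge_mono)
qed (simp add: pole_mult_def Least_le)

lemma pole_mult_bound: "mat_ord_ge \<alpha> (- int (pole_mult \<alpha> \<Phi>)) \<Phi>"
  using pole_mult_le_iff by blast

lemma pole_mult_mult_regular:
  fixes M \<Phi> :: "ratfun ^ 'n ^ 'n"
  assumes "\<And>i j. regular \<alpha> (M $ i $ j)"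
  shows "pole_mult \<alpha> (\<Phi> ** M) \<le> pole_mult \<alpha> \<Phi>"
  unfolding pole_mult_le_iff mat_ord_ge_def det_mul
  using pole_mult_bound[of \<alpha> \<Phi>] ord_ge_matrix_mult[of \<alpha> _ \<Phi> 0 M] assms
    ord_ge_mult[OF _ regular_det[of \<alpha> M]]
  by (fastforce simp: mat_ord_ge_def)

lemma pole_mult_transpose: "pole_mult \<alpha> (transpose \<Phi>) = pole_mult \<alpha> \<Phi>"
  by (simp add: pole_mult_def mat_ord_ge_def transpose_def[of \<Phi>] conj_commute det_transpose[unfolded transpose_def])
    (rule arg_cong[of _ _ Least], blast)

lemma det_2_add:
  fixes A B :: "'a::comm_ring_1 ^ 2 ^ 2"
  shows "det (A + B) = det A + det B + (A $ 1 $ 1 * B $ 2 $ 2 + A $ 2 $ 2 * B $ 1 $ 1)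
      - (A $ 1 $ 2 * B $ 2 $ 1 + A $ 2 $ 1 * B $ 1 $ 2)"
  by (simp add: det_2 algebra_simps)

text \<open>
  The mixed terms in the determinant of the sum are products of an entry of \<open>\<Phi>\<close> with a regular
  function. Size two is essential: in a larger determinant there are mixed terms that
  contain minors of \<open>\<Phi>\<close> of intermediate size.
\<close>

lemma pole_mult_add_regular:
  fixes \<Phi> A :: "ratfun ^ 2 ^ 2"
  assumes "\<And>i j. regular \<alpha> (A $ i $ j)"
  shows "pole_mult \<alpha> (\<Phi> + A) \<le> pole_mult \<alpha> \<Phi>"
proof -
  define m where "m = - int (pole_mult \<alpha> \<Phi>)"
  have \<Phi>: "ord_ge \<alpha> m (\<Phi> $ i $ j)" "ord_ge \<alpha> m (det \<Phi>)" for i j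
    using pole_mult_bound[of \<alpha> \<Phi>] by (auto simp: m_def mat_ord_ge_def)
  have A: "ord_ge \<alpha> m r" if "regular \<alpha> r" for r
    using ord_ge_mono[OF that] by (simp add: m_def)
  have mixed: "ord_ge \<alpha> m (\<Phi> $ i $ j * A $ k $ l)" for i j k l
    using ord_ge_mult[OF \<Phi>(1) assms] by simp
  have "ord_ge \<alpha> m (det (\<Phi> + A))"
    unfolding det_2_add by (intro ord_ge_add ord_ge_diff mixed \<Phi> A regular_det assms)
  moreover have "ord_ge \<alpha> m ((\<Phi> + A) $ i $ j)" for i j
    unfolding vector_add_component by (intro ord_ge_add \<Phi>(1) A assms)
  ultimately show ?thesis unfolding pole_mult_le_iff mat_ord_ge_def m_def[symmetric] by blast
qed

text \<open>
  The entries of the inverse are, up to sign, the entries of \<open>M\<close> divided by its determinant, and its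
  determinant is the minor \<open>1\<close> of size zero divided by it: taking inverses permutes the minors and
  divides them by \<open>det M\<close>.
\<close>

lemma pole_mult_inverse:
  fixes M N :: "ratfun ^ 2 ^ 2"
  assumes "M ** N = mat 1"
  shows "int (pole_mult \<alpha> N) \<le> int (pole_mult \<alpha> M) + rat_ord \<alpha> (det M)"
proof -
  define m where "m = int (pole_mult \<alpha> M)"
  have M: "ord_ge \<alpha> (- m) (M $ i $ j)" "ord_ge \<alpha> (- m) (det M)" for i j
    using pole_mult_bound[of \<alpha> M] by (auto simp: m_def mat_ord_ge_def)
  have dd: "det M * det N = 1" using assms by (metis det_I det_mul)
  hence nz: "det M \<noteq> 0" "det N \<noteq> 0" by auto
  have dn: "rat_ord \<alpha> (det N) = - rat_ord \<alpha> (det M)"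
    using arg_cong[OF dd, of "rat_ord \<alpha>"] nz by (simp add: rat_ord_mult)
  have le: "0 \<le> m + rat_ord \<alpha> (det M)" using M(2) nz by (simp add: ord_ge_def)
  have e: "M $ 1 $ 1 * N $ 1 $ 1 + M $ 1 $ 2 * N $ 2 $ 1 = 1" "M $ 1 $ 1 * N $ 1 $ 2 + M $ 1 $ 2 * N $ 2 $ 2 = 0"
    "M $ 2 $ 1 * N $ 1 $ 1 + M $ 2 $ 2 * N $ 2 $ 1 = 0" "M $ 2 $ 1 * N $ 1 $ 2 + M $ 2 $ 2 * N $ 2 $ 2 = 1"
    using assms by (auto simp: vec_eq_iff matrix_matrix_mult_def sum_2 mat_def forall_2)
  have "N $ 1 $ 1 * det M = M $ 2 $ 2" "N $ 1 $ 2 * det M = - M $ 1 $ 2"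
    "N $ 2 $ 1 * det M = - M $ 2 $ 1" "N $ 2 $ 2 * det M = M $ 1 $ 1"
    using e unfolding det_2 by algebra+
  hence "ord_ge \<alpha> (- m) (N $ i $ j * det M)" for i j
    using M(1) exhaust_2[of i] exhaust_2[of j] by auto
  hence "ord_ge \<alpha> (- (m + rat_ord \<alpha> (det M))) (N $ i $ j)" for i j
    using nz by (simp add: ord_ge_mult_iff)
  moreover have "ord_ge \<alpha> (- (m + rat_ord \<alpha> (det M))) (det N)"
    using pole_mult_bound[of \<alpha> M] by (auto simp: ord_ge_def dn m_def)
  ultimately have "mat_ord_ge \<alpha> (- int (nat (m + rat_ord \<alpha> (det M)))) N"
    using le by (auto simp: mat_ord_ge_def)
  hence "pole_mult \<alpha> N \<le> nat (m + rat_ord \<alpha> (det M))" by (simp only: pole_mult_le_iff)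
  thus ?thesis using le by (simp add: m_def)
qed

section \<open>Blaschke--Potapov products\<close>

text \<open>
  The rows of \<open>M\<close> form a basis of row vectors adapted to the decomposition into the row space of \<open>P\<close>,
  on which multiplication by \<open>P\<close> from the right is the identity, and its kernel.
\<close>

lemma idempotent_diagonalizable:
  fixes P :: "'a::field ^ 'n ^ 'n"
  assumes "P ** P = P"
  obtains M D where "det M \<noteq> 0" "M ** P = (\<chi> i j. if i = j \<and> i \<in> D then 1 else 0) ** M"
    "card D = rank P"
proof -
  obtain B1 where B1: "B1 \<subseteq> vec.span (rows P)" "vec.independent B1" "vec.span (rows P) \<subseteq> vec.span B1"
    "card B1 = vec.dim (vec.span (rows P))"
    by (rule vec.basis_exists[of "vec.span (rows P)"])
  obtain B2 where B2: "B2 \<subseteq> {x. x v* P = 0}" "vec.independent B2" "{x. x v* P = 0} \<subseteq> vec.span B2"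
    by (rule vec.basis_exists[of "{x. x v* P = 0}"])
  have fin: "finite B1" "finite B2" using B1(2) B2(2) by (auto intro: vec.finiteI_independent)
  have mult_sum: "(\<Sum>x\<in>A. c x *s x) v* P = (\<Sum>x\<in>A. c x *s (x v* P))" for A :: "('a ^ 'n) set" and c
    by (simp add: vec_eq_iff vector_matrix_mult_def sum_distrib_left sum_distrib_right sum.swap[of _ A] mult.assoc)
  have rows: "row i P v* P = row i P" for i
  proof -
    have "row i P v* P = row i (P ** P)"
      by (simp add: vec_eq_iff vector_matrix_mult_def row_def matrix_matrix_mult_def mult.commute)
    thus ?thesis by (simp add: assms)
  qed
  have "vec.span (rows P) \<subseteq> {x. x v* P = x}"
  proof (rule vec.span_minimal)
    show "rows P \<subseteq> {x. x v* P = x}" using rows by (auto simp: rows_def)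
    show "vec.subspace {x. x v* P = x}"
      by (auto simp: vec.subspace_def vec_eq_iff vector_matrix_mult_def algebra_simps sum.distrib
          sum_distrib_left[symmetric])
  qed
  with B1 have fix1: "x v* P = x" if "x \<in> B1" for x using that by auto
  have fix2: "x v* P = 0" if "x \<in> B2" for x using that B2 by auto
  have "0 \<notin> B1" using B1(2) vec.dependent_zero by blast
  hence disj: "B1 \<inter> B2 = {}" using fix1 fix2 by force
  have indep: "vec.independent (B1 \<union> B2)"
  proof (rule vec.independent_if_scalars_zero)
    fix c x assume c: "(\<Sum>x\<in>B1 \<union> B2. c x *s x) = 0" and x: "x \<in> B1 \<union> B2"
    have split: "(\<Sum>x\<in>B1. c x *s x) + (\<Sum>x\<in>B2. c x *s x) = 0"
      using c by (simp add: sum.union_disjoint fin disj)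
    have "(\<Sum>x\<in>B1. c x *s x) = (\<Sum>x\<in>B1 \<union> B2. c x *s x) v* P"
      unfolding mult_sum by (simp add: sum.union_disjoint fin disj fix1 fix2)
    also have "\<dots> = 0" by (simp add: c)
    finally have 1: "(\<Sum>x\<in>B1. c x *s x) = 0" .
    with split have 2: "(\<Sum>x\<in>B2. c x *s x) = 0" by simp
    show "c x = 0" using x 1 2 B1(2) B2(2) fin by (auto simp: vec.independent_explicit)
  qed (use fin in auto)
  have span: "vec.span (B1 \<union> B2) = UNIV"
  proof -
    have "x \<in> vec.span (B1 \<union> B2)" for x
    proof -
      have "x v* P = (\<Sum>i\<in>UNIV. x $ i *s row i P)"
        by (simp add: vec_eq_iff vector_matrix_mult_def row_def mult.commute)
      also have "\<dots> \<in> vec.span (rows P)"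
        by (intro vec.span_sum vec.span_scale vec.span_base) (auto simp: rows_def)
      finally have 1: "x v* P \<in> vec.span (B1 \<union> B2)"
        using B1(3) vec.span_mono[of B1 "B1 \<union> B2"] by blast
      have "(x - x v* P) v* P = x v* P - x v* (P ** P)"
        by (simp add: vector_matrix_mul_assoc[symmetric]) (simp add: vec_eq_iff vector_matrix_mult_def algebra_simps sum_subtractf)
      hence "x - x v* P \<in> vec.span (B1 \<union> B2)"
        using assms B2(3) vec.span_mono[of B2 "B1 \<union> B2"] by auto
      from vec.span_add[OF 1 this] show ?thesis by simp
    qed
    thus ?thesis by blast
  qed
  have "card (B1 \<union> B2) = CARD('n)"
    using vec.dim_eq_card_independent[OF indep] vec.dim_span[of "B1 \<union> B2"] span vec_dim_card[where 'a='a and 'n='n] by metis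
  then obtain f where f: "bij_betw f (UNIV :: 'n set) (B1 \<union> B2)"
    using fin by (metis finite_UnI finite_same_card_bij finite)
  define M where "M = (\<chi> i. f i)"
  have "rows M = B1 \<union> B2" using f by (auto simp: rows_def row_def M_def bij_betw_def vec_nth_inverse)
  have "vec.span (rows M) = UNIV" by (simp add: \<open>rows M = B1 \<union> B2\<close> span)
  hence "det M \<noteq> 0"
    by (simp add: invertible_det_nz[symmetric] invertible_left_inverse matrix_left_invertible_span_rows_gen)
  moreover have "M ** P = (\<chi> i j. if i = j \<and> i \<in> {i. f i \<in> B1} then 1 else 0) ** M"
  proof -
    have "(M ** P) $ i = (if f i \<in> B1 then f i else 0)" for i
    proof -
      have "(M ** P) $ i = f i v* P"
        by (simp add: M_def vec_eq_iff vector_matrix_mult_def matrix_matrix_mult_def mult.commute)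
      moreover have "f i \<in> B1 \<union> B2" using f by (auto simp: bij_betw_def)
      ultimately show ?thesis using fix1 fix2 by auto
    qed
    moreover have "((\<chi> i j. if i = j \<and> i \<in> {i. f i \<in> B1} then 1 else 0) ** M) $ i = (if f i \<in> B1 then f i else 0)" for i
      by (simp add: M_def vec_eq_iff matrix_matrix_mult_def if_distrib[of "\<lambda>x. x * _"] sum.delta' cong: if_cong)
    ultimately show ?thesis by (simp only: vec_eq_iff[of "M ** P"] simp_thms)
  qed
  moreover have "card {i. f i \<in> B1} = rank P"
  proof -
    have "f ` {i. f i \<in> B1} = B1" using f by (auto simp: bij_betw_def image_iff)
    moreover have "inj_on f {i. f i \<in> B1}" using f by (auto simp: bij_betw_def inj_on_def)
    ultimately have "card {i. f i \<in> B1} = card B1" by (metis card_image)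
    thus ?thesis by (simp add: B1(4) row_rank_def_gen vec.dim_span)
  qed
  ultimately show ?thesis by (rule that)
qed

definition blaschke :: "complex \<Rightarrow> ratfun" where
  "blaschke \<alpha> = (rat_const \<alpha> - rat_z) / (1 - rat_const (cnj \<alpha>) * rat_z)"

lemma conj_denominator_nonzero:
  assumes "norm \<alpha> < 1" "norm z \<le> 1"
  shows "1 - cnj \<alpha> * z \<noteq> 0"
proof
  assume "1 - cnj \<alpha> * z = 0"
  hence "norm (cnj \<alpha> * z) = norm (1 :: complex)" by simp
  moreover have "norm (cnj \<alpha> * z) \<le> norm \<alpha> * 1" unfolding norm_mult complex_mod_cnj
    by (intro mult_left_mono) (use assms in auto)
  ultimately show False using assms by simp
qed

lemma rat_conj_denominator:
  "regular z (1 - rat_const \<beta> * rat_z)" "rat_eval (1 - rat_const \<beta> * rat_z) z = 1 - \<beta> * z"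
  by (simp_all add: ord_ge_diff regular_mult ord_ge_const rat_eval_diff rat_eval_mult)

lemma rat_conj_denominator_nonzero: "1 - rat_const \<beta> * rat_z \<noteq> 0"
  using rat_conj_denominator(2)[of \<beta> 0] by auto

lemma rat_conj_denominator_ord:
  assumes "norm \<alpha> < 1" "norm z \<le> 1"
  shows "rat_ord z (1 - rat_const (cnj \<alpha>) * rat_z) = 0"
  unfolding rat_ord_eq_0_iff[OF rat_conj_denominator_nonzero]
  using assms conj_denominator_nonzero rat_conj_denominator by metis

lemma blaschke_nonzero [simp]: "blaschke \<alpha> \<noteq> 0"
  using rat_conj_denominator_nonzero[of "cnj \<alpha>"] rat_linear_nonzero(2)[of \<alpha>]
  unfolding blaschke_def divide_eq_0_iff by blast

lemma rat_ord_blaschke: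
  assumes "norm \<alpha> < 1" "norm z \<le> 1"
  shows "rat_ord z (blaschke \<alpha>) = (if z = \<alpha> then 1 else 0)"
proof -
  have "rat_const (-1) \<noteq> 0" unfolding rat_const_simps by simp
  from rat_ord_mult[OF this rat_linear_nonzero(1)[of \<alpha>], of z]
  have "rat_ord z (rat_const (-1) * (rat_z - rat_const \<alpha>)) = (if z = \<alpha> then 1 else 0)"
    by (simp add: rat_ord_const rat_ord_linear)
  moreover have "rat_const (-1) * (rat_z - rat_const \<alpha>) = rat_const \<alpha> - rat_z"
    by (simp add: rat_const_hom)
  ultimately show ?thesis unfolding blaschke_def
    rat_ord_divide[OF rat_linear_nonzero(2) rat_conj_denominator_nonzero]
    using assms by (simp add: rat_conj_denominator_ord)
qed

lemma regular_blaschke: "norm \<alpha> < 1 \<Longrightarrow> norm z \<le> 1 \<Longrightarrow> regular z (blaschke \<alpha>)"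
  by (simp add: ord_ge_def rat_ord_blaschke)

lemma bp_factor_nth:
  "bp_factor \<alpha> P $ i $ j = blaschke \<alpha> * rat_const (P $ i $ j) + rat_const ((mat 1 - P) $ i $ j)"
  by (simp add: bp_factor_def blaschke_def map_matrix_def)

lemma det_map_const: "det (map_matrix rat_const A) = rat_const (det A)"
proof -
  have "rat_const (\<Prod>i\<in>I. f i) = (\<Prod>i\<in>I. rat_const (f i))" for f and I :: "'a set"
    by (induction I rule: infinite_finite_induct) (simp_all add: rat_const_hom)
  hence "rat_const (\<Prod>i\<in>UNIV. A $ i $ p i) = (\<Prod>i\<in>UNIV. rat_const (A $ i $ p i))" for p
    by simp
  thus ?thesis by (simp add: det_def rat_const_sum rat_const_hom map_matrix_def rat_const_of_int)
qed

lemma det_bp_factor: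
  assumes "P ** P = P"
  shows "det (bp_factor \<alpha> P) = blaschke \<alpha> ^ rank P"
proof -
  obtain M D where MD: "det M \<noteq> 0" "M ** P = (\<chi> i j. if i = j \<and> i \<in> D then 1 else 0) ** M"
    "card D = rank P" using idempotent_diagonalizable[OF assms] .
  define E :: "ratfun ^ 'a ^ 'a" where "E = (\<chi> i j. if i = j then (if i \<in> D then blaschke \<alpha> else 1) else 0)"
  define M' where "M' = map_matrix rat_const M"
  have *: "(M ** P) $ i $ j = (if i \<in> D then M $ i $ j else 0)" for i j
    unfolding MD(2) by (simp add: matrix_matrix_mult_def if_distrib[of "\<lambda>x. x * _"] cong: if_cong)
  have **: "(M ** (mat 1 - P)) $ i $ j = (if i \<in> D then 0 else M $ i $ j)" for i j
  proof -
    have "M ** (mat 1 - P) + M ** P = M" by (simp flip: matrix_add_ldistrib)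
    hence "(M ** (mat 1 - P)) $ i $ j + (M ** P) $ i $ j = M $ i $ j" by (metis vector_add_component)
    thus ?thesis using *[of i j] by (simp split: if_splits)
  qed
  have "M' ** bp_factor \<alpha> P = E ** M'"
  proof -
    have "(M' ** bp_factor \<alpha> P) $ i $ j = (E ** M') $ i $ j" for i j
    proof -
      have "(M' ** bp_factor \<alpha> P) $ i $ j
          = blaschke \<alpha> * rat_const ((M ** P) $ i $ j) + rat_const ((M ** (mat 1 - P)) $ i $ j)"
        by (simp only: bp_factor_nth matrix_matrix_mult_def M'_def map_matrix_def vec_lambda_beta rat_const_sum
            rat_const_hom distrib_left sum.distrib sum_distrib_left mult.left_commute)
      also have "\<dots> = (E ** M') $ i $ j" unfolding * **
        by (simp add: E_def M'_def map_matrix_def matrix_matrix_mult_def if_distrib[of "\<lambda>x. x * _"] cong: if_cong)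
      finally show ?thesis .
    qed
    thus ?thesis by (simp add: vec_eq_iff)
  qed
  hence "det M' * det (bp_factor \<alpha> P) = det E * det M'" by (metis det_mul)
  moreover have "det M' \<noteq> 0" using MD(1) by (simp add: M'_def det_map_const)
  moreover have "det E = blaschke \<alpha> ^ rank P"
    by (subst det_diagonal) (auto simp: E_def prod.If_cases MD(3))
  ultimately show ?thesis by simp
qed

lemma regular_bp_factor: "norm \<alpha> < 1 \<Longrightarrow> norm z \<le> 1 \<Longrightarrow> regular z (bp_factor \<alpha> P $ i $ j)"
  unfolding bp_factor_nth by (intro ord_ge_add regular_mult regular_blaschke ord_ge_const)

lemma blaschke_potapov_regular:
  fixes B :: "ratfun ^ 'n ^ 'n"
  assumes "blaschke_potapov B d" "norm z \<le> 1"
  shows "regular z (B $ i $ j)"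
  using assms
proof (induction arbitrary: i j rule: blaschke_potapov.induct)
  case (const U)
  thus ?case by (simp add: map_matrix_def ord_ge_const)
next
  case (factor B d \<alpha> P)
  thus ?case using ord_ge_matrix_mult[of z 0 B 0 "bp_factor \<alpha> P"] regular_bp_factor[of \<alpha> z P] by simp
qed

lemma det_unitary_nonzero: "unitary_matrix U \<Longrightarrow> det U \<noteq> 0"
  unfolding unitary_matrix_def by (metis det_I det_mul mult_zero_left zero_neq_one mult_zero_right)

text \<open>
  The determinant of \<open>B\<close> is a constant times a scalar Blaschke product, in which a factor with
  projection \<open>P\<close> contributes \<open>rank P\<close> zeros. The degree thus counts the zeros of \<open>det B\<close>.
\<close>

lemma blaschke_potapov_det:
  assumes "blaschke_potapov B d" "finite S" "S \<subseteq> ball 0 1"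
  shows "det B \<noteq> 0 \<and> (\<Sum>z\<in>S. rat_ord z (det B)) \<le> int d"
  using assms
proof (induction rule: blaschke_potapov.induct)
  case (const U)
  thus ?case by (simp add: det_map_const det_unitary_nonzero rat_ord_const)
next
  case (factor B d \<alpha> P)
  have P: "P ** P = P" using factor by (simp add: orth_projection_def)
  have "(\<Sum>z\<in>S. rat_ord z (blaschke \<alpha> ^ rank P)) = (\<Sum>z\<in>S. if z = \<alpha> then int (rank P) else 0)"
    by (intro sum.cong refl, subst rat_ord_power) (use factor in \<open>auto simp: rat_ord_blaschke\<close>)
  also have "\<dots> \<le> int (rank P)" using factor by simp
  finally show ?case using factor by (simp add: det_mul det_bp_factor[OF P] rat_ord_mult sum.distrib)
qed

text \<open>
  A pole in the closed disk would be a limit of points of the open disk at which the function is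
  large; this covers poles on the circle as well.
\<close>

lemma Hinf_regular:
  assumes "rat_eval r \<in> Hinf" "norm z \<le> 1"
  shows "regular z r"
proof -
  obtain a b where r: "r = to_fract a / to_fract b" "b \<noteq> 0" "coprime a b"
    "a = fst (quot_of_fract r)" "b = snd (quot_of_fract r)" by (rule fract_lowest_terms)
  obtain K where K: "\<And>w. w \<in> ball 0 1 \<Longrightarrow> norm (rat_eval r w) \<le> K"
    using assms(1) unfolding Hinf_def bounded_iff by blast
  define F where "F = {w. poly b w = 0}"
  define C where "C = {w. norm (poly a w) \<le> K * norm (poly b w)}"
  have "finite F" unfolding F_def using r(2) by (rule poly_roots_finite)
  have "z islimpt ball 0 1" using assms(2) by (simp add: islimpt_ball)
  moreover have "ball 0 1 \<subseteq> F \<union> C"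
  proof
    fix w :: complex assume w: "w \<in> ball 0 1"
    show "w \<in> F \<union> C"
    proof (cases "w \<in> F")
      case False
      thus ?thesis using K[OF w]
        by (simp add: F_def C_def rat_eval_def r(4,5)[symmetric] norm_divide field_simps)
    qed auto
  qed
  ultimately have "z islimpt C" using \<open>finite F\<close> islimpt_subset islimpt_Un_finite by blast
  moreover have "closed C" unfolding C_def by (intro closed_Collect_le continuous_intros)
  ultimately have "z \<in> C" by (simp add: closed_limpt)
  have "poly b z \<noteq> 0"
  proof
    assume b: "poly b z = 0"
    with \<open>z \<in> C\<close> have "poly a z = 0" by (simp add: C_def)
    with b show False using coprime_no_common_root[OF r(3)] by blast
  qed
  thus ?thesis by (simp add: regular_iff_denominator r(5))
qed

text \<open>
  By Cramer's rule, applied to the rows, \<open>\<Phi>\<^sub>i\<^sub>k det B\<close> is the determinant of the matrix \<open>B\<close> with row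
  \<open>k\<close> replaced by row \<open>i\<close> of \<open>\<Phi> B\<close>, and all entries of that matrix are regular at \<open>\<alpha>\<close>.
\<close>

lemma pole_mult_le_bp_det:
  fixes B \<Phi> :: "ratfun ^ 'n ^ 'n"
  assumes B: "blaschke_potapov B d" and an: "\<And>i j. regular \<alpha> ((\<Phi> ** B) $ i $ j)" and \<alpha>: "norm \<alpha> < 1"
  shows "int (pole_mult \<alpha> \<Phi>) \<le> rat_ord \<alpha> (det B)"
proof -
  have nz: "det B \<noteq> 0" using blaschke_potapov_det[OF B, of "{}"] by simp
  have det: "regular \<alpha> (det \<Phi> * det B)" using regular_det[of \<alpha> "\<Phi> ** B"] an by (simp add: det_mul)
  have entries: "regular \<alpha> (\<Phi> $ i $ k * det B)" for i k
  proof -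
    have "(\<Sum>j\<in>UNIV. \<Phi> $ i $ j *s row j B) = (\<Phi> ** B) $ i"
      by (simp add: vec_eq_iff row_def matrix_matrix_mult_def)
    with cramer_lemma_transpose[where A = B and x = "\<Phi> $ i" and k = k]
    have "\<Phi> $ i $ k * det B = det (\<chi> j. if j = k then (\<Phi> ** B) $ i else row j B)" by metis
    also have "regular \<alpha> \<dots>"
      by (rule regular_det) (use an blaschke_potapov_regular[OF B] \<alpha> in \<open>auto simp: row_def\<close>)
    finally show ?thesis .
  qed
  have "regular \<alpha> (det B)" using blaschke_potapov_regular[OF B] \<alpha> by (intro regular_det) auto
  hence ge: "rat_ord \<alpha> (det B) \<ge> 0" using nz by (simp add: ord_ge_def)
  have "mat_ord_ge \<alpha> (- int (nat (rat_ord \<alpha> (det B)))) \<Phi>"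
    using det entries nz ge by (simp add: mat_ord_ge_def ord_ge_mult_iff)
  hence "pole_mult \<alpha> \<Phi> \<le> nat (rat_ord \<alpha> (det B))" by (simp only: pole_mult_le_iff)
  with ge show ?thesis by linarith
qed

section \<open>The degree as a number of poles\<close>

text \<open>
  The matrix \<open>1 - Q\<close> is the orthogonal projection onto the complement of the line spanned by \<open>y\<close>.
\<close>

lemma complement_of_line_projection:
  fixes y :: "complex ^ 2"
  assumes "y \<noteq> 0"
  defines "N \<equiv> of_real ((norm (y $ 1))\<^sup>2 + (norm (y $ 2))\<^sup>2)"
  defines "Q \<equiv> (\<chi> i j. y $ i * cnj (y $ j) / N) :: complex ^ 2 ^ 2"
  shows "orth_projection (mat 1 - Q)" "rank (mat 1 - Q) \<le> 1"
    "trace (mat 1 - Q) = 1" "det (mat 1 - Q) = 0"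
proof -
  have N: "N = y $ 1 * cnj (y $ 1) + y $ 2 * cnj (y $ 2)"
    unfolding N_def of_real_add by (simp only: complex_norm_square)
  have "N \<noteq> 0"
  proof
    assume "N = 0"
    hence "(norm (y $ 1))\<^sup>2 + (norm (y $ 2))\<^sup>2 = 0" unfolding N_def of_real_eq_0_iff .
    hence "y $ 1 = 0 \<and> y $ 2 = 0" by (simp add: sum_power2_eq_zero_iff)
    thus False using assms(1) by (simp add: vec_eq_iff forall_2)
  qed
  have cN: "cnj N = N" by (simp add: N_def)
  have PQ: "mat 1 - Q = (\<chi> i j. (if i = 1 then - cnj (y $ 2) else cnj (y $ 1)) * (if j = 1 then - y $ 2 else y $ 1) / N)"
    using \<open>N \<noteq> 0\<close> by (simp add: vec_eq_iff forall_2 mat_def Q_def field_simps) (simp add: N field_simps)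
  show "orth_projection (mat 1 - Q)"
    unfolding orth_projection_def PQ ctranspose_def using \<open>N \<noteq> 0\<close>
    by (simp add: vec_eq_iff forall_2 matrix_matrix_mult_def sum_2 map_matrix_def transpose_def cN field_simps)
      (simp add: N field_simps power2_eq_square)
  show "trace (mat 1 - Q) = 1"
    unfolding PQ trace_def using \<open>N \<noteq> 0\<close> by (simp add: sum_2 field_simps) (simp add: N field_simps)
  show "det (mat 1 - Q) = 0" unfolding PQ by (simp add: det_2)
  have "rows (mat 1 - Q) \<subseteq> vec.span {vector [- y $ 2, y $ 1]}"
  proof
    fix r assume "r \<in> rows (mat 1 - Q)"
    then obtain i where "r = row i (mat 1 - Q)" by (auto simp: rows_def)
    hence "r = ((if i = 1 then - cnj (y $ 2) else cnj (y $ 1)) / N) *s vector [- y $ 2, y $ 1]"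
      unfolding PQ by (simp add: vec_eq_iff forall_2 row_def)
    thus "r \<in> vec.span {vector [- y $ 2, y $ 1]}" by (simp add: vec.span_scale vec.span_base)
  qed
  hence "vec.dim (rows (mat 1 - Q)) \<le> card {vector [- y $ 2, y $ 1] :: complex ^ 2}"
    by (intro vec.dim_le_card) auto
  thus "rank (mat 1 - Q) \<le> 1" by (simp add: row_rank_def_gen)
qed

text \<open>
  Let \<open>m > 0\<close> be the multiplicity. The coefficient \<open>C\<close> of \<open>(z - \<alpha>)\<^sup>-\<^sup>m\<close> in \<open>\<Phi>\<close> is singular, since
  otherwise the determinant would have a pole of order \<open>2m > m\<close>. Choose \<open>y \<noteq> 0\<close> with \<open>C y = 0\<close> and
  let \<open>P\<close> project onto the complement of \<open>y\<close>. The factor leaves \<open>\<Phi> y\<close> alone, which has a pole of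
  order less than \<open>m\<close>, and multiplies the component of \<open>\<Phi>\<close> along \<open>P\<close>, as well as the determinant,
  by a function vanishing at \<open>\<alpha>\<close>.
\<close>

lemma pole_reducing_factor:
  fixes \<Phi> :: "ratfun ^ 2 ^ 2"
  assumes \<alpha>: "norm \<alpha> < 1" and pos: "pole_mult \<alpha> \<Phi> > 0"
  obtains P where "orth_projection P" "rank P \<le> 1" "pole_mult \<alpha> (\<Phi> ** bp_factor \<alpha> P) < pole_mult \<alpha> \<Phi>"
proof -
  define m where "m = pole_mult \<alpha> \<Phi>"
  define \<pi> where "\<pi> = rat_z - rat_const \<alpha>"
  have \<pi>: "\<pi> \<noteq> 0" "rat_ord \<alpha> \<pi> = 1"
    unfolding \<pi>_def using rat_linear_nonzero(1) by (blast, simp add: rat_ord_linear)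
  have \<Phi>: "ord_ge \<alpha> (- int m) (\<Phi> $ i $ j)" "ord_ge \<alpha> (- int m) (det \<Phi>)" for i j
    using pole_mult_bound[of \<alpha> \<Phi>] by (auto simp: m_def mat_ord_ge_def)
  define R where "R = (\<chi> i j. \<Phi> $ i $ j * \<pi> ^ m)"
  have R: "regular \<alpha> (R $ i $ j)" for i j
    using \<Phi>(1) \<pi> by (simp add: R_def ord_ge_mult_iff rat_ord_power)
  define C where "C = (\<chi> i j. rat_eval (R $ i $ j) \<alpha>)"
  \<comment> \<open>The determinant of \<open>R\<close> still vanishes at \<open>\<alpha>\<close>, since only half of \<open>\<pi> ^ (2 * m)\<close> is used up.\<close>
  have "det R = det \<Phi> * \<pi> ^ (2 * m)"
    unfolding mult_2 power_add by (simp add: R_def det_2 algebra_simps)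
  hence "ord_ge \<alpha> (int m) (det R)"
    using \<Phi>(2) \<pi> by (simp add: ord_ge_mult_iff rat_ord_power)
  hence "ord_ge \<alpha> 1 (det R)" by (rule ord_ge_mono) (use pos in \<open>simp add: m_def\<close>)
  hence "rat_eval (det R) \<alpha> = 0" by (simp add: ord_ge_1_iff)
  moreover have "rat_eval (det R) \<alpha> = det C"
    using R by (simp add: C_def det_2 rat_eval_diff rat_eval_mult regular_mult)
  ultimately have "det C = 0" by simp
  then obtain y where y: "y \<noteq> 0" "C *v y = 0"
    using invertible_det_nz[of C] by (auto simp: invertible_left_inverse matrix_left_invertible_ker)
  define N :: complex where "N = of_real ((norm (y $ 1))\<^sup>2 + (norm (y $ 2))\<^sup>2)"
  define Q where "Q = ((\<chi> i j. y $ i * cnj (y $ j) / N) :: complex ^ 2 ^ 2)"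
  \<comment> \<open>\<open>Q\<close> projects onto the line spanned by \<open>y\<close>.\<close>
  define P where "P = mat 1 - Q"
  have P: "orth_projection P" "rank P \<le> 1" "trace P = 1" "det P = 0"
    using complement_of_line_projection[OF y(1)] unfolding P_def Q_def N_def by blast+
  have IP: "mat 1 - P = Q" by (simp add: P_def)
  have "ord_ge \<alpha> (1 - int m) (\<Phi> $ i $ 1 * rat_const (y $ 1) + \<Phi> $ i $ 2 * rat_const (y $ 2))" for i
  proof -
    have "rat_eval (R $ i $ 1 * rat_const (y $ 1) + R $ i $ 2 * rat_const (y $ 2)) \<alpha> = (C *v y) $ i"
      using R by (simp add: C_def matrix_vector_mult_def sum_2 rat_eval_add rat_eval_mult regular_mult ord_ge_const)
    hence "ord_ge \<alpha> 1 (R $ i $ 1 * rat_const (y $ 1) + R $ i $ 2 * rat_const (y $ 2))"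
      using R y(2) by (simp add: ord_ge_1_iff ord_ge_add regular_mult ord_ge_const)
    moreover have "R $ i $ 1 * rat_const (y $ 1) + R $ i $ 2 * rat_const (y $ 2)
      = (\<Phi> $ i $ 1 * rat_const (y $ 1) + \<Phi> $ i $ 2 * rat_const (y $ 2)) * \<pi> ^ m"
      by (simp add: R_def algebra_simps)
    ultimately show ?thesis using \<pi> by (simp add: ord_ge_mult_iff rat_ord_power)
  qed
  note ker = this
  have entry: "ord_ge \<alpha> (1 - int m) ((\<Phi> ** bp_factor \<alpha> P) $ i $ j)" for i j
  proof -
    have "(\<Phi> ** bp_factor \<alpha> P) $ i $ j
        = blaschke \<alpha> * (\<Sum>k\<in>UNIV. rat_const (P $ k $ j) * \<Phi> $ i $ k)
          + rat_const (cnj (y $ j) / N) * (\<Phi> $ i $ 1 * rat_const (y $ 1) + \<Phi> $ i $ 2 * rat_const (y $ 2))"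
    proof -
      have Q: "rat_const (Q $ k $ j) = rat_const (cnj (y $ j) / N) * rat_const (y $ k)" for k
        by (simp add: Q_def flip: rat_const_hom)
      show ?thesis unfolding matrix_matrix_mult_def vec_lambda_beta bp_factor_nth IP sum_2 Q
        by algebra
    qed
    moreover have "ord_ge \<alpha> (1 + - int m) (blaschke \<alpha> * (\<Sum>k\<in>UNIV. rat_const (P $ k $ j) * \<Phi> $ i $ k))"
      by (intro ord_ge_mult ord_ge_sum ord_ge_cmult \<Phi>) (use \<alpha> in \<open>simp add: ord_ge_def rat_ord_blaschke\<close>)
    ultimately show ?thesis using ord_ge_cmult[OF ker] by (auto intro!: ord_ge_add)
  qed
  have det: "det (bp_factor \<alpha> P) = blaschke \<alpha>"
  proof -
    have "det (bp_factor \<alpha> P) = 1 + (blaschke \<alpha> - 1) * rat_const (trace P) + (blaschke \<alpha> - 1)\<^sup>2 * rat_const (det P)"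
      unfolding det_2 bp_factor_nth trace_def sum_2 rat_const_hom vector_minus_component mat_def
      by (simp add: power2_eq_square) algebra
    thus ?thesis by (simp add: P)
  qed
  have "ord_ge \<alpha> 1 (blaschke \<alpha>)" using \<alpha> by (simp add: ord_ge_def rat_ord_blaschke)
  from ord_ge_mult[OF \<Phi>(2) this] have "ord_ge \<alpha> (1 + - int m) (det (\<Phi> ** bp_factor \<alpha> P))"
    by (simp add: det_mul det add.commute)
  with entry have "mat_ord_ge \<alpha> (- int (m - 1)) (\<Phi> ** bp_factor \<alpha> P)"
    using pos by (simp add: mat_ord_ge_def m_def of_nat_diff)
  hence "pole_mult \<alpha> (\<Phi> ** bp_factor \<alpha> P) \<le> m - 1" by (simp only: pole_mult_le_iff)
  with P pos show ?thesis by (intro that[of P]) (auto simp: m_def)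
qed

lemma blaschke_potapov_one: "blaschke_potapov (mat 1 :: ratfun ^ 'n ^ 'n) 0"
proof -
  have "unitary_matrix (mat 1 :: complex ^ 'n ^ 'n)"
    by (simp add: unitary_matrix_def ctranspose_def transpose_mat) (simp add: map_matrix_def mat_def vec_eq_iff)
  hence "blaschke_potapov (map_matrix rat_const (mat 1 :: complex ^ 'n ^ 'n)) 0" by (rule blaschke_potapov.const)
  moreover have "map_matrix rat_const (mat 1 :: complex ^ 'n ^ 'n) = mat 1"
    by (simp add: map_matrix_def mat_def vec_eq_iff)
  ultimately show ?thesis by simp
qed

text \<open>
  Among the products \<open>B\<close> whose degree does not exceed the number of poles that they have removed,
  take one for which the fewest poles of \<open>\<Phi> B\<close> remain. If any remained, one more factor on the right
  would remove another.
\<close>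

lemma blaschke_potapov_exists:
  fixes \<Phi> :: "ratfun ^ 2 ^ 2"
  assumes S: "finite S" "S \<subseteq> ball 0 1" and out: "\<And>\<alpha>. \<alpha> \<in> ball 0 1 - S \<Longrightarrow> pole_mult \<alpha> \<Phi> = 0"
  shows "\<exists>B d. blaschke_potapov B d \<and> d \<le> (\<Sum>\<alpha>\<in>S. pole_mult \<alpha> \<Phi>)
    \<and> (\<forall>\<alpha>\<in>ball 0 1. pole_mult \<alpha> (\<Phi> ** B) = 0)"
proof -
  define N where "N = (\<Sum>\<alpha>\<in>S. pole_mult \<alpha> \<Phi>)"
  \<comment> \<open>Of the \<open>N\<close> poles \<open>k\<close> remain, and every unit of degree spent has removed one.\<close>
  define good where "good k \<longleftrightarrow> (\<exists>B d. blaschke_potapov B d \<and> (\<Sum>\<alpha>\<in>S. pole_mult \<alpha> (\<Phi> ** B)) = k \<and> d + k \<le> N)" for k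
  have "good N" unfolding good_def using blaschke_potapov_one
    by (intro exI[of _ "mat 1"] exI[of _ 0]) (simp add: N_def)
  define k where "k = (LEAST k. good k)"
  have "good k" unfolding k_def using \<open>good N\<close> by (rule LeastI)
  then obtain B d where B: "blaschke_potapov B d" "(\<Sum>\<alpha>\<in>S. pole_mult \<alpha> (\<Phi> ** B)) = k" "d + k \<le> N"
    unfolding good_def by blast
  have "k = 0"
  proof (rule ccontr)
    assume "k \<noteq> 0"
    then obtain \<alpha> where \<alpha>: "\<alpha> \<in> S" "pole_mult \<alpha> (\<Phi> ** B) > 0" using B(2) S(1) by (metis gr0I sum.neutral)
    hence n\<alpha>: "norm \<alpha> < 1" using S(2) by auto
    obtain P where P: "orth_projection P" "rank P \<le> 1"
      "pole_mult \<alpha> (\<Phi> ** B ** bp_factor \<alpha> P) < pole_mult \<alpha> (\<Phi> ** B)"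
      using pole_reducing_factor[OF n\<alpha> \<alpha>(2)] .
    define B' where "B' = B ** bp_factor \<alpha> P"
    define k' where "k' = (\<Sum>\<beta>\<in>S. pole_mult \<beta> (\<Phi> ** B'))"
    have B': "blaschke_potapov B' (d + rank P)"
      unfolding B'_def by (intro blaschke_potapov.factor) (use B n\<alpha> P in auto)
    have "k' < k" unfolding k'_def B(2)[symmetric] B'_def matrix_mul_assoc
    proof (rule sum_strict_mono_ex1)
      show "\<forall>\<beta>\<in>S. pole_mult \<beta> (\<Phi> ** B ** bp_factor \<alpha> P) \<le> pole_mult \<beta> (\<Phi> ** B)"
        using S(2) by (auto intro!: pole_mult_mult_regular regular_bp_factor n\<alpha>)
    qed (use S \<alpha> P in auto)
    moreover have "good k'" unfolding good_def using B' P(2) B(3) \<open>k' < k\<close> k'_def by fastforce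
    ultimately show False unfolding k_def using not_less_Least by blast
  qed
  have "pole_mult \<alpha> (\<Phi> ** B) = 0" if "\<alpha> \<in> ball 0 1" for \<alpha>
  proof (cases "\<alpha> \<in> S")
    case True
    thus ?thesis using B(2) \<open>k = 0\<close> S(1) by simp
  next
    case False
    have "pole_mult \<alpha> (\<Phi> ** B) \<le> pole_mult \<alpha> \<Phi>"
      using that by (intro pole_mult_mult_regular blaschke_potapov_regular[OF B(1)]) auto
    thus ?thesis using out[of \<alpha>] that False by simp
  qed
  thus ?thesis using B N_def by fastforce
qed

lemma regular_Hinf:
  assumes "\<And>z. norm z \<le> 1 \<Longrightarrow> regular z r"
  shows "rat_eval r \<in> Hinf"
proof -
  have "rat_eval r analytic_on cball 0 1" using assms by (intro rat_eval_analytic) auto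
  hence h: "rat_eval r holomorphic_on cball 0 1" by (rule analytic_imp_holomorphic)
  hence "bounded (rat_eval r ` cball 0 1)"
    by (intro compact_imp_bounded compact_continuous_image holomorphic_on_imp_continuous_on) auto
  hence "bounded (rat_eval r ` ball 0 1)" by (rule bounded_subset) auto
  moreover have "rat_eval r holomorphic_on ball 0 1" using h by (rule holomorphic_on_subset) auto
  ultimately show ?thesis by (simp add: Hinf_def)
qed

lemma blaschke_potapov_scalar:
  assumes "finite S" "S \<subseteq> ball 0 1"
  shows "\<exists>d. blaschke_potapov (mat (\<Prod>\<alpha>\<in>S. blaschke \<alpha> ^ k) :: ratfun ^ 'n ^ 'n) d"
  using assms
proof (induction S)
  case empty
  thus ?case using blaschke_potapov_one by auto
next
  case (insert \<alpha> S)
  have P: "orth_projection (mat 1 :: complex ^ 'n ^ 'n)"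
    by (simp add: orth_projection_def ctranspose_def transpose_mat) (simp add: map_matrix_def mat_def vec_eq_iff)
  have step: "mat r ** bp_factor \<alpha> (mat 1) = (mat (blaschke \<alpha> * r) :: ratfun ^ 'n ^ 'n)" for r
    by (simp add: vec_eq_iff matrix_matrix_mult_def bp_factor_nth mat_def if_distrib[of "\<lambda>x. x * _"]
      if_distrib[of "\<lambda>x. _ * x"] if_distrib[of rat_const] mult.commute cong: if_cong)
  have "\<exists>d. blaschke_potapov (mat (blaschke \<alpha> ^ k * r) :: ratfun ^ 'n ^ 'n) d"
    if "blaschke_potapov (mat r :: ratfun ^ 'n ^ 'n) d" for r d
  proof (induction k)
    case (Suc k)
    then obtain d' where "blaschke_potapov (mat (blaschke \<alpha> ^ k * r) :: ratfun ^ 'n ^ 'n) d'" by blast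
    from blaschke_potapov.factor[OF this _ P, of \<alpha>] insert.prems show ?case
      by (auto simp: step mult.assoc)
  qed (use that in auto)
  thus ?case using insert by auto
qed

text \<open>
  The degree is a least number, so it satisfies its defining property only if some
  Blaschke--Potapov product cancels all poles; a scalar one with zeros of high order does.
\<close>

lemma bp_degree_attained:
  fixes \<Phi> :: "ratfun ^ 'n ^ 'n"
  assumes circle: "\<And>z i j. norm z = 1 \<Longrightarrow> regular z (\<Phi> $ i $ j)"
  obtains B where "blaschke_potapov B (bp_degree \<Phi>)" "\<And>z i j. norm z \<le> 1 \<Longrightarrow> regular z ((\<Phi> ** B) $ i $ j)"
proof -
  define S where "S = (\<Union>i. \<Union>j. {\<alpha>. \<not> regular \<alpha> (\<Phi> $ i $ j)}) \<inter> ball 0 1"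
  have S: "finite S" "S \<subseteq> ball 0 1" by (auto simp: S_def intro!: finite_nonregular)
  define k where "k = (\<Sum>\<alpha>\<in>S. pole_mult \<alpha> \<Phi>)"
  have k: "ord_ge \<alpha> (- int k) (\<Phi> $ i $ j)" if "\<alpha> \<in> S" for \<alpha> i j
  proof -
    have "pole_mult \<alpha> \<Phi> \<le> k" unfolding k_def by (rule member_le_sum) (use that S in auto)
    thus ?thesis by (simp add: pole_mult_le_iff mat_ord_ge_def)
  qed
  define r where "r = (\<Prod>\<alpha>\<in>S. blaschke \<alpha> ^ k)"
  have r: "r \<noteq> 0" using S by (simp add: r_def)
  have ord: "rat_ord z r = (if z \<in> S then int k else 0)" if "norm z \<le> 1" for z
  proof -
    have "rat_ord z r = (\<Sum>\<alpha>\<in>S. if z = \<alpha> then int k else 0)"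
      unfolding r_def by (subst rat_ord_prod, simp, intro sum.cong)
        (use S that in \<open>auto simp: rat_ord_power rat_ord_blaschke\<close>)
    thus ?thesis using S by simp
  qed
  have "regular z (\<Phi> $ i $ j * r)" if "norm z \<le> 1" for z i j
  proof (cases "z \<in> S")
    case True
    thus ?thesis using k[OF True] r ord[OF that] by (simp add: ord_ge_mult_iff)
  next
    case False
    hence "regular z (\<Phi> $ i $ j)" using that circle[of z] by (cases "norm z = 1") (auto simp: S_def)
    thus ?thesis using r ord[OF that] False by (simp add: ord_ge_mult_iff)
  qed
  moreover have "(\<Phi> ** (mat r :: ratfun ^ 'n ^ 'n)) $ i $ j = \<Phi> $ i $ j * r" for i j
    by (simp add: matrix_matrix_mult_def mat_def if_distrib[of "\<lambda>x. _ * x"] cong: if_cong)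
  ultimately have "\<forall>i j. rat_eval ((\<Phi> ** (mat r :: ratfun ^ 'n ^ 'n)) $ i $ j) \<in> Hinf"
    by (auto intro!: regular_Hinf)
  with blaschke_potapov_scalar[OF S, of k, where 'n = 'n]
  have "\<exists>d B. blaschke_potapov B d \<and> (\<forall>i j. rat_eval ((\<Phi> ** B) $ i $ j) \<in> Hinf)"
    unfolding r_def by blast
  hence "\<exists>B. blaschke_potapov B (bp_degree \<Phi>) \<and> (\<forall>i j. rat_eval ((\<Phi> ** B) $ i $ j) \<in> Hinf)"
    unfolding bp_degree_def by (rule LeastI_ex)
  thus ?thesis using that Hinf_regular by blast
qed

lemma sum_pole_mult_le_bp_degree:
  fixes \<Phi> :: "ratfun ^ 'n ^ 'n"
  assumes circle: "\<And>z i j. norm z = 1 \<Longrightarrow> regular z (\<Phi> $ i $ j)"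
    and S: "finite S" "S \<subseteq> ball 0 1"
  shows "(\<Sum>\<alpha>\<in>S. pole_mult \<alpha> \<Phi>) \<le> bp_degree \<Phi>"
proof -
  obtain B where B: "blaschke_potapov B (bp_degree \<Phi>)"
    "\<And>z i j. norm z \<le> 1 \<Longrightarrow> regular z ((\<Phi> ** B) $ i $ j)"
    using bp_degree_attained[of \<Phi>] circle by blast
  have "int (\<Sum>\<alpha>\<in>S. pole_mult \<alpha> \<Phi>) \<le> (\<Sum>\<alpha>\<in>S. rat_ord \<alpha> (det B))"
    unfolding of_nat_sum by (intro sum_mono pole_mult_le_bp_det[OF B(1)]) (use B(2) S in auto)
  also have "\<dots> \<le> int (bp_degree \<Phi>)" using blaschke_potapov_det[OF B(1) S] by blast
  finally show ?thesis by (simp only: of_nat_le_iff)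
qed

lemma bp_degree_le:
  fixes \<Phi> :: "ratfun ^ 2 ^ 2"
  assumes S: "finite S" "S \<subseteq> ball 0 1" and out: "\<And>\<alpha>. \<alpha> \<in> ball 0 1 - S \<Longrightarrow> pole_mult \<alpha> \<Phi> = 0"
    and circle: "\<And>z i j. norm z = 1 \<Longrightarrow> regular z (\<Phi> $ i $ j)"
  shows "bp_degree \<Phi> \<le> (\<Sum>\<alpha>\<in>S. pole_mult \<alpha> \<Phi>)"
proof -
  obtain B d where B: "blaschke_potapov B d" "d \<le> (\<Sum>\<alpha>\<in>S. pole_mult \<alpha> \<Phi>)"
    "\<forall>\<alpha>\<in>ball 0 1. pole_mult \<alpha> (\<Phi> ** B) = 0" using blaschke_potapov_exists[OF S out] by blast
  have "regular z ((\<Phi> ** B) $ i $ j)" if "norm z \<le> 1" for z i j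
  proof (cases "norm z = 1")
    case True
    thus ?thesis using ord_ge_matrix_mult[of z 0 \<Phi> 0 B] circle blaschke_potapov_regular[OF B(1)] by simp
  next
    case False
    hence "z \<in> ball 0 1" using that by simp
    hence "pole_mult z (\<Phi> ** B) \<le> 0" using B(3) by simp
    thus ?thesis unfolding pole_mult_le_iff by (simp add: mat_ord_ge_def)
  qed
  hence "\<forall>i j. rat_eval ((\<Phi> ** B) $ i $ j) \<in> Hinf" by (blast intro: regular_Hinf)
  hence "bp_degree \<Phi> \<le> d" unfolding bp_degree_def using B(1) by (intro Least_le) blast
  with B(2) show ?thesis by simp
qed

section \<open>The Riesz projections of a rational function\<close>

lemma poly_split_roots:
  fixes b :: "complex poly"
  assumes "b \<noteq> 0"
  shows "\<exists>b1 b2. b = b1 * b2 \<and> (\<forall>z. poly b1 z = 0 \<longrightarrow> Q z) \<and> (\<forall>z. poly b2 z = 0 \<longrightarrow> \<not> Q z)"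
  using assms
proof (induction "degree b" arbitrary: b rule: less_induct)
  case less
  show ?case
  proof (cases "\<exists>z. poly b z = 0 \<and> Q z")
    case False
    thus ?thesis by (intro exI[of _ 1] exI[of _ b]) auto
  next
    case True
    then obtain \<beta> where \<beta>: "poly b \<beta> = 0" "Q \<beta>" by blast
    then obtain c where c: "b = [:-\<beta>, 1:] * c" by (auto simp: poly_eq_0_iff_dvd dvd_def)
    hence "c \<noteq> 0" using less.prems by auto
    hence "degree c < degree b" unfolding c by (subst degree_mult_eq) auto
    from less.hyps[OF this \<open>c \<noteq> 0\<close>] obtain c1 c2 where
      "c = c1 * c2" "\<forall>z. poly c1 z = 0 \<longrightarrow> Q z" "\<forall>z. poly c2 z = 0 \<longrightarrow> \<not> Q z" by blast
    moreover from this have "b = [:-\<beta>, 1:] * c1 * c2" by (simp only: c mult.assoc)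
    moreover have "\<forall>z. poly ([:-\<beta>, 1:] * c1) z = 0 \<longrightarrow> Q z" using calculation \<beta>(2) by auto
    ultimately show ?thesis by blast
  qed
qed

lemma coprime_poly_roots:
  fixes p q :: "complex poly"
  assumes "\<And>z. poly p z = 0 \<Longrightarrow> poly q z \<noteq> 0" "p \<noteq> 0"
  shows "coprime p q"
proof (rule coprimeI)
  fix d assume d: "d dvd p" "d dvd q"
  hence "d \<noteq> 0" using assms(2) by auto
  have "degree d = 0"
  proof (rule ccontr)
    assume "degree d \<noteq> 0"
    hence "\<not> constant (poly d)" by (simp add: constant_degree)
    from Fundamental_Theorem_Algebra.fundamental_theorem_of_algebra[OF this] obtain z where "poly d z = 0" by blast
    hence "poly p z = 0 \<and> poly q z = 0" using d by (auto elim!: dvdE)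
    thus False using assms(1) by blast
  qed
  thus "is_unit d" using \<open>d \<noteq> 0\<close> by (simp add: is_unit_iff_degree)
qed

text \<open>
  Partial fractions: the denominator is the product of a factor with all roots inside the circle
  and one with all roots outside, and these are coprime. The inner summand is taken to be a proper
  fraction, which makes it vanish at infinity.
\<close>

lemma circle_split:
  assumes "\<And>z. norm z = 1 \<Longrightarrow> regular z r"
  obtains s q where "r = s + q" "\<And>z. norm z \<le> 1 \<Longrightarrow> regular z s" "\<And>z. norm z \<ge> 1 \<Longrightarrow> regular z q"
    "\<And>z. norm z \<le> 1 \<Longrightarrow> regular z (rat_flat q)" "rat_eval (rat_flat q) 0 = 0"
proof -
  obtain a b where r: "r = to_fract a / to_fract b" "b \<noteq> 0" "coprime a b"
    "a = fst (quot_of_fract r)" "b = snd (quot_of_fract r)" by (rule fract_lowest_terms)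
  obtain b1 b2 where b: "b = b1 * b2" "\<And>z. poly b1 z = 0 \<Longrightarrow> norm z \<le> 1" "\<And>z. poly b2 z = 0 \<Longrightarrow> \<not> norm z \<le> 1"
    using poly_split_roots[OF r(2), of "\<lambda>z. norm z \<le> 1"] by blast
  have nz: "b1 \<noteq> 0" "b2 \<noteq> 0" using b(1) r(2) by auto
  have b1: "norm z < 1" if "poly b1 z = 0" for z
  proof -
    have "poly b z = 0" using that by (simp add: b(1))
    hence "\<not> regular z r" by (simp add: regular_iff_denominator r(5))
    hence "norm z \<noteq> 1" using assms by blast
    with b(2)[OF that] show ?thesis by simp
  qed
  have "coprime b1 b2" by (rule coprime_poly_roots) (use b nz in auto)
  then obtain x y where xy: "x * b1 + y * b2 = 1"
    using bezout_coefficients_fst_snd[of b1 b2] by (metis coprime_iff_gcd_eq_1)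
  define k m where "k = (a * y) div b1" and "m = (a * y) mod b1"
  have km: "a * y = k * b1 + m" by (simp add: k_def m_def)
  have m: "m = 0 \<or> degree m < degree b1" using degree_mod_less[OF nz(1), of "a * y"] by (simp add: m_def)
  define q where "q = to_fract m / to_fract b1"
  define s where "s = to_fract (k * b2 + a * x) / to_fract b2"
  have "a = (k * b2 + a * x) * b1 + m * b2"
  proof -
    have "a = a * (x * b1 + y * b2)" by (simp add: xy)
    also have "\<dots> = a * x * b1 + (a * y) * b2" by (simp add: algebra_simps)
    finally show ?thesis unfolding km by (simp add: algebra_simps)
  qed
  hence "to_fract a = to_fract (k * b2 + a * x) * to_fract b1 + to_fract m * to_fract b2"
    by (metis to_fract_add to_fract_mult)
  moreover have "to_fract b = to_fract b1 * to_fract b2" by (simp add: b(1))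
  moreover have "to_fract b1 \<noteq> 0" "to_fract b2 \<noteq> 0" using nz by auto
  ultimately have 1: "r = s + q" unfolding r(1) s_def q_def
    by (simp only: add_divide_distrib) (simp add: field_simps)
  have 2: "regular z s" if "norm z \<le> 1" for z
    unfolding s_def by (rule regular_divide_poly) (use b(3) that in blast)
  have 3: "regular z q" if "norm z \<ge> 1" for z
    unfolding q_def by (rule regular_divide_poly) (use b1[of z] that in auto)
  have fl: "rat_flat q = to_fract (reflect_poly m * [:0, 1:] ^ (degree b1 - degree m)) / to_fract (reflect_poly b1)"
    unfolding q_def by (rule rat_flat_divide_poly) (use nz m in auto)
  have d: "poly (reflect_poly b1) z \<noteq> 0" if "norm z \<le> 1" for z
  proof (cases "z = 0")
    case True
    thus ?thesis using nz by simp
  next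
    case False
    hence "norm (inverse z) \<ge> 1" using that by (simp add: norm_inverse one_le_inverse)
    hence "poly b1 (inverse z) \<noteq> 0" using b1 by fastforce
    with False show ?thesis by (simp add: poly_reflect_poly_nz)
  qed
  have 4: "regular z (rat_flat q)" if "norm z \<le> 1" for z
    unfolding fl by (rule regular_divide_poly[OF d[OF that]])
  have 5: "rat_eval (rat_flat q) 0 = 0"
    unfolding fl by (subst rat_eval_divide) (use d[of 0] m in auto)
  show ?thesis using that 1 2 3 4 5 by blast
qed

lemma regular_cdisk_power_series:
  assumes "\<And>z. norm z \<le> 1 \<Longrightarrow> regular z s"
  obtains a where "summable (\<lambda>n. norm (a n))" "\<And>z. norm z \<le> 1 \<Longrightarrow> (\<lambda>n. a n * z ^ n) sums rat_eval s z"
    "a 0 = rat_eval s 0"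
proof -
  \<comment> \<open>No pole lies in the disk of radius \<open>R\<close>; the number \<open>2\<close> only keeps the set nonempty.\<close>
  define R where "R = Min (insert 2 (norm ` {z. \<not> regular z s}))"
  have fin: "finite (insert 2 (norm ` {z. \<not> regular z s}))" using finite_nonregular by simp
  have R: "R > 1" unfolding R_def using fin assms by (subst Min_gr_iff) force+
  have "regular z s" if "norm z < R" for z
  proof (rule ccontr)
    assume "\<not> regular z s"
    hence "R \<le> norm z" unfolding R_def using fin by (intro Min_le) auto
    with that show False by simp
  qed
  hence "rat_eval s analytic_on ball 0 R" by (intro rat_eval_analytic) auto
  hence hol: "rat_eval s holomorphic_on ball 0 R" by (rule analytic_imp_holomorphic)
  define a where "a n = (deriv ^^ n) (rat_eval s) 0 / fact n" for n
  have sums: "(\<lambda>n. a n * z ^ n) sums rat_eval s z" if "norm z < R" for z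
    using holomorphic_power_series[OF hol, of z] that by (simp add: a_def)
  \<comment> \<open>Convergence at a point beyond the circle gives absolute convergence at \<open>1\<close>.\<close>
  define x :: complex where "x = of_real ((1 + R) / 2)"
  have "norm x = (1 + R) / 2" unfolding x_def norm_of_real using R by simp
  hence x: "norm x < R" "norm x > 1" using R by auto
  have "summable (\<lambda>n. norm (a n * 1 ^ n))"
    by (rule powser_insidea[OF sums_summable[OF sums[OF x(1)]]]) (use x in simp)
  hence "summable (\<lambda>n. norm (a n))" by simp
  moreover have "a 0 = rat_eval s 0" by (simp add: a_def)
  ultimately show ?thesis using that[of a] sums R by fastforce
qed

lemma circle_measure_density:
  "circle_measure = distr (density lborel (\<lambda>x. ennreal (indicator {0..2 * pi} x / (2 * pi)))) borel cis"
proof -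
  have "indicator {0..2 * pi} x / emeasure lborel {0..2 * pi} = ennreal (indicator {0..2 * pi} x / (2 * pi))" for x :: real
    by (auto simp: indicator_def divide_ennreal[symmetric])
  thus ?thesis unfolding circle_measure_def uniform_measure_def by simp
qed

lemma measurable_cis [measurable]: "cis \<in> borel_measurable borel"
  by (intro borel_measurable_continuous_onI continuous_intros)

lemma prob_space_circle: "prob_space circle_measure"
  unfolding circle_measure_def
  by (intro prob_space.prob_space_distr prob_space_uniform_measure) auto

lemma sets_circle [measurable_cong]: "sets circle_measure = sets borel"
  by (simp add: circle_measure_def)

lemma space_circle [simp]: "space circle_measure = UNIV"
  by (simp add: circle_measure_def)

lemma AE_circle: "AE z in circle_measure. norm z = 1"
  unfolding circle_measure_def by (subst AE_distr_iff) auto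

lemma measurable_power_int [measurable]: "(\<lambda>z::complex. z powi k) \<in> borel_measurable borel"
  unfolding power_int_def by (cases "k \<ge> 0") (auto intro!: borel_measurable_power)

lemma integral_circle_power_int: "integral\<^sup>L circle_measure (\<lambda>z. z powi k) = (if k = 0 then 1 else 0)"
proof (cases "k = 0")
  case True
  thus ?thesis using prob_space.prob_space[OF prob_space_circle] by simp
next
  case False
  have "integral\<^sup>L circle_measure (\<lambda>z. z powi k)
      = integral\<^sup>L (density lborel (\<lambda>x. ennreal (indicator {0..2 * pi} x / (2 * pi)))) (\<lambda>x. cis x powi k)"
    unfolding circle_measure_density by (rule integral_distr) auto
  also have "\<dots> = integral\<^sup>L lborel (\<lambda>x. (indicator {0..2 * pi} x / (2 * pi)) *\<^sub>R (cis x powi k))"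
    by (rule integral_density) auto
  also have "\<dots> = integral\<^sup>L lborel (\<lambda>x. (1 / (2 * pi)) *\<^sub>R (indicator {0..2 * pi} x *\<^sub>R cis (of_int k * x)))"
    by (simp add: cis_power_int)
  also have "\<dots> = (1 / (2 * pi)) *\<^sub>R integral\<^sup>L lborel (\<lambda>x. indicator {0..2 * pi} x *\<^sub>R cis (of_int k * x))"
    by (rule integral_scaleR_right)
  also have "integral\<^sup>L lborel (\<lambda>x. indicator {0..2 * pi} x *\<^sub>R cis (of_int k * x))
      = cis (of_int k * (2 * pi)) / (\<i> * of_int k) - cis (of_int k * 0) / (\<i> * of_int k)"
  proof (rule integral_FTC_Icc)
    fix x :: real
    have "((\<lambda>x. cis (of_int k * x)) has_vector_derivative (of_int k * (\<i> * cis (of_int k * x)))) (at x within {0..2 * pi})"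
      by (auto intro!: derivative_eq_intros simp: has_vector_derivative_def scaleR_conv_of_real)
    thus "((\<lambda>x. cis (of_int k * x) / (\<i> * of_int k)) has_vector_derivative cis (of_int k * x)) (at x within {0..2 * pi})"
      by (rule has_vector_derivative_eq_rhs[OF has_vector_derivative_divide]) (use False in simp)
  qed (auto intro!: continuous_intros)
  also have "cis (of_int k * (2 * pi)) = 1"
    using cis_power_int[of "2 * pi" k] by simp
  finally show ?thesis using False by simp
qed

text \<open>
  The Laurent series on the circle converges absolutely and may be integrated term by term. The
  condition \<open>c 0 = 0\<close> makes the splitting into the two series unique.
\<close>

lemma fourier_coeff_Laurent:
  assumes f [measurable]: "f \<in> borel_measurable borel"
    and sum: "summable (\<lambda>n. norm (a n))" "summable (\<lambda>n. norm (c n))" and c0: "c 0 = 0"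
    and eq: "\<And>z. norm z = 1 \<Longrightarrow> f z = (\<Sum>n. a n * z ^ n) + (\<Sum>n. c n * cnj z ^ n)"
  shows "fourier_coeff f (int j) = a j"
proof -
  interpret prob_space circle_measure by (rule prob_space_circle)
  define h where "h n z = a n * z powi (int n - int j) + c n * z powi (- int n - int j)" for n z
  have [measurable]: "h n \<in> borel_measurable borel" for n unfolding h_def by measurable
  have bound: "norm (h n z) \<le> norm (a n) + norm (c n)" if "norm z = 1" for n z
    unfolding h_def by (rule norm_triangle_le) (simp add: norm_mult norm_power_int that)
  have summ: "summable (\<lambda>n. norm (a n) + norm (c n))" using sum by (rule summable_add)
  have int_pow: "integrable circle_measure (\<lambda>z. z powi k)" for k
    by (rule integrable_const_bound[of _ 1]) (use AE_circle in \<open>auto simp: norm_power_int\<close>)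
  have int: "integrable circle_measure (h n)" for n
    unfolding h_def by (intro Bochner_Integration.integrable_add integrable_mult_right int_pow)
  have "AE z in circle_measure. f z * z powi (- int j) = (\<Sum>n. h n z)"
    using AE_circle
  proof eventually_elim
    case (elim z)
    have z: "z \<noteq> 0" "cnj z = inverse z" using elim inverse_on_circle[of z] by (auto simp: inverse_eq_divide)
    have "summable (\<lambda>n. a n * z ^ n)" "summable (\<lambda>n. c n * cnj z ^ n)"
      by (rule summable_norm_cancel, use sum elim in \<open>simp add: norm_mult norm_power\<close>)+
    hence "(\<lambda>n. (a n * z ^ n + c n * cnj z ^ n) * z powi (- int j)) sums (f z * z powi (- int j))"
      unfolding eq[OF elim] by (intro sums_mult2 sums_add summable_sums)
    moreover have "(a n * z ^ n + c n * cnj z ^ n) * z powi (- int j) = h n z" for n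
    proof -
      have "z powi (int n - int j) = z ^ n * z powi (- int j)"
        using power_int_add[of z "int n" "- int j"] z(1) by simp
      moreover have "z powi (- int n - int j) = cnj z ^ n * z powi (- int j)"
        using power_int_add[of z "- int n" "- int j"] z by (simp add: power_int_minus power_inverse)
      ultimately show ?thesis by (simp add: h_def algebra_simps)
    qed
    ultimately show ?case by (simp add: sums_unique)
  qed
  hence "fourier_coeff f (int j) = integral\<^sup>L circle_measure (\<lambda>z. \<Sum>n. h n z)"
    unfolding fourier_coeff_def by (intro integral_cong_AE) measurable
  also have "\<dots> = (\<Sum>n. integral\<^sup>L circle_measure (h n))"
  proof (rule integral_suminf[OF int])
    show "AE z in circle_measure. summable (\<lambda>n. norm (h n z))"
      using AE_circle
    proof eventually_elim
      case (elim z)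
      show ?case by (rule summable_comparison_test[OF _ summ]) (use bound[OF elim] in auto)
    qed
    show "summable (\<lambda>n. \<integral>z. norm (h n z) \<partial>circle_measure)"
    proof (rule summable_comparison_test[OF _ summ], intro exI[of _ 0] allI impI)
      fix n
      have "(\<integral>z. norm (h n z) \<partial>circle_measure) \<le> norm (a n) + norm (c n)"
        by (rule integral_le_const) (use int AE_circle bound in \<open>auto elim!: eventually_mono\<close>)
      thus "norm (\<integral>z. norm (h n z) \<partial>circle_measure) \<le> norm (a n) + norm (c n)" by simp
    qed
  qed
  also have "(\<lambda>n. integral\<^sup>L circle_measure (h n)) = (\<lambda>n. if n = j then a j else 0)"
  proof
    fix n
    have "integral\<^sup>L circle_measure (h n) = a n * (if int n - int j = 0 then 1 else 0) + c n * (if - int n - int j = 0 then 1 else 0)"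
      unfolding h_def integral_circle_power_int[symmetric]
      by (simp add: int_pow)
    thus "integral\<^sup>L circle_measure (h n) = (if n = j then a j else 0)" using c0 by auto
  qed
  also have "(\<Sum>n. if n = j then a j else 0) = a j"
    using sums_single[of j "\<lambda>_. a j"] by (simp add: sums_iff)
  finally show ?thesis .
qed

lemma riesz_plus_eq:
  assumes "\<And>z. norm z \<le> 1 \<Longrightarrow> regular z s" "\<And>z. norm z \<ge> 1 \<Longrightarrow> regular z q"
    "\<And>z. norm z \<le> 1 \<Longrightarrow> regular z (rat_flat q)" "rat_eval (rat_flat q) 0 = 0"
  shows "riesz_plus (s + q) = s"
proof -
  obtain a where a: "summable (\<lambda>n. norm (a n))" "\<And>z. norm z \<le> 1 \<Longrightarrow> (\<lambda>n. a n * z ^ n) sums rat_eval s z"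
    by (rule regular_cdisk_power_series[of s]) (use assms(1) in auto)
  obtain c where c: "summable (\<lambda>n. norm (c n))"
    "\<And>z. norm z \<le> 1 \<Longrightarrow> (\<lambda>n. c n * z ^ n) sums rat_eval (rat_flat q) z" "c 0 = rat_eval (rat_flat q) 0"
    by (rule regular_cdisk_power_series[of "rat_flat q"]) (use assms(3) in auto)
  have c0: "c 0 = 0" using c(3) assms(4) by simp
  have "fourier_coeff (rat_eval (s + q)) (int j) = a j" for j
  proof (rule fourier_coeff_Laurent[OF _ a(1) c(1) c0])
    fix z :: complex assume z: "norm z = 1"
    have "rat_eval (s + q) z = rat_eval s z + rat_eval q z"
      using assms(1,2)[of z] z by (simp add: rat_eval_add)
    also have "rat_eval q z = rat_eval (rat_flat q) (cnj z)"
      using rat_flat_circle(2)[of "cnj z" q] assms(2) z by simp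
    finally show "rat_eval (s + q) z = (\<Sum>n. a n * z ^ n) + (\<Sum>n. c n * cnj z ^ n)"
      using a(2)[of z] c(2)[of "cnj z"] z by (simp add: sums_iff)
  qed measurable
  hence s: "(\<lambda>j. fourier_coeff (rat_eval (s + q)) (int j) * z ^ j) sums rat_eval s z" if "norm z = 1" for z
    using a(2)[of z] that by simp
  show ?thesis unfolding riesz_plus_def
  proof (rule the_equality)
    fix s' assume s': "\<forall>z\<in>sphere 0 1. (\<lambda>j. fourier_coeff (rat_eval (s + q)) (int j) * z ^ j) sums rat_eval s' z"
    have "\<forall>\<^sub>F z in circle_cofinite. rat_eval s' z = rat_eval s z"
      using eventually_circle_norm
    proof eventually_elim
      case (elim z)
      with s' have "(\<lambda>j. fourier_coeff (rat_eval (s + q)) (int j) * z ^ j) sums rat_eval s' z" by simp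
      thus ?case using s[OF elim] by (rule sums_unique2)
    qed
    thus "s' = s" by (rule ratfun_eqI_circle)
  qed (use s in auto)
qed

text \<open>
  The power series of the two summands of \<open>circle_split\<close>, the second in \<open>1 / z\<close>, form the Fourier
  series, so these summands are the two Riesz projections.
\<close>

lemma riesz_projections:
  assumes "\<And>z. norm z = 1 \<Longrightarrow> regular z r"
  shows "norm z \<le> 1 \<Longrightarrow> regular z (riesz_plus r)"
    and "norm z \<ge> 1 \<Longrightarrow> regular z (riesz_minus r)"
    and "norm z \<le> 1 \<Longrightarrow> regular z (rat_flat (riesz_minus r))"
proof -
  obtain s q where sq: "r = s + q" "\<And>z. norm z \<le> 1 \<Longrightarrow> regular z s" "\<And>z. norm z \<ge> 1 \<Longrightarrow> regular z q"
    "\<And>z. norm z \<le> 1 \<Longrightarrow> regular z (rat_flat q)" "rat_eval (rat_flat q) 0 = 0"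
    by (rule circle_split[of r]) (use assms in auto)
  have "riesz_plus r = s" unfolding sq(1) by (rule riesz_plus_eq) (use sq in auto)
  moreover from this have "riesz_minus r = q" by (simp add: riesz_minus_def sq(1))
  ultimately show "norm z \<le> 1 \<Longrightarrow> regular z (riesz_plus r)" "norm z \<ge> 1 \<Longrightarrow> regular z (riesz_minus r)"
    "norm z \<le> 1 \<Longrightarrow> regular z (rat_flat (riesz_minus r))" using sq by simp_all
qed

section \<open>Badly approximable unimodular functions have negative index\<close>

lemma unimodular_regular:
  assumes "\<And>z. norm z = 1 \<Longrightarrow> norm (rat_eval u z) = 1" "norm z = 1"
  shows "regular z u"
proof (rule ccontr)
  assume "\<not> regular z u"
  hence "rat_eval u z = 0" by (simp add: regular_iff_denominator rat_eval_def)
  with assms(1)[OF assms(2)] show False by simp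
qed

lemma unimodular_mult_sharp:
  assumes "\<And>z. norm z = 1 \<Longrightarrow> norm (rat_eval u z) = 1"
  shows "u * rat_sharp u = 1"
proof (rule ratfun_eqI_circle)
  show "\<forall>\<^sub>F z in circle_cofinite. rat_eval (u * rat_sharp u) z = rat_eval 1 z"
    using eventually_circle_norm eventually_rat_eval_sharp[of u]
  proof eventually_elim
    case (elim z)
    hence "rat_eval (u * rat_sharp u) z = rat_eval u z * cnj (rat_eval u z)" by (simp add: rat_eval_mult)
    also have "\<dots> = of_real ((norm (rat_eval u z))\<^sup>2)" by (rule complex_norm_square[symmetric])
    finally show ?case using assms elim by simp
  qed
qed

text \<open>
  Outside the disk a zero of \<open>v\<close> is reflected to a pole inside and vice versa, because
  \<open>v v\<^sup># = 1\<close>. Hence \<open>v\<close> has neither zeros nor poles in the plane.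
\<close>

lemma unimodular_constant:
  assumes uni: "\<And>z. norm z = 1 \<Longrightarrow> norm (rat_eval v z) = 1" and ord: "\<And>z. norm z < 1 \<Longrightarrow> rat_ord z v = 0"
  obtains c where "v = rat_const c" "c \<noteq> 0"
proof -
  have vs: "v * rat_sharp v = 1" using uni by (rule unimodular_mult_sharp)
  hence nz: "v \<noteq> 0" "rat_sharp v \<noteq> 0" by auto
  have "rat_ord z v = 0" for z
  proof (cases "norm z \<le> 1")
    case True
    show ?thesis
    proof (cases "norm z = 1")
      case True
      thus ?thesis using nz uni[OF True] unimodular_regular[OF uni True] by (auto simp: rat_ord_eq_0_iff)
    qed (use True ord in auto)
  next
    case False
    hence z: "z \<noteq> 0" "norm (1 / cnj z) < 1" by (auto simp: norm_divide divide_simps)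
    hence "regular (1 / cnj z) v" "rat_eval v (1 / cnj z) \<noteq> 0"
      using ord[OF z(2)] nz by (simp_all add: rat_ord_eq_0_iff)
    hence "rat_ord z (rat_sharp v) = 0" using nz z(1)
      by (simp add: rat_ord_eq_0_iff regular_sharp rat_eval_sharp_regular)
    moreover have "rat_ord z v + rat_ord z (rat_sharp v) = 0" using vs nz by (metis rat_ord_mult rat_ord_1)
    ultimately show ?thesis by simp
  qed
  note ord0 = this
  obtain a b where v: "v = to_fract a / to_fract b" "b \<noteq> 0" "coprime a b"
    "a = fst (quot_of_fract v)" "b = snd (quot_of_fract v)" by (rule fract_lowest_terms)
  have roots: "poly a z \<noteq> 0 \<and> poly b z \<noteq> 0" for z
  proof -
    have "regular z v" "rat_eval v z \<noteq> 0" using ord0[of z] nz by (simp_all add: rat_ord_eq_0_iff)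
    thus ?thesis by (auto simp: regular_iff_denominator rat_eval_def v(4) v(5))
  qed
  have const: "\<exists>c. p = [:c:]" if "\<And>z. poly p z \<noteq> 0" for p :: "complex poly"
  proof -
    have "constant (poly p)" using that Fundamental_Theorem_Algebra.fundamental_theorem_of_algebra[of p] by metis
    hence "degree p = 0" by (simp add: constant_degree)
    thus ?thesis by (rule degree_eq_zeroE) blast
  qed
  from const[of a] const[of b] roots obtain c d where cd: "a = [:c:]" "b = [:d:]" by blast
  have "v = rat_const (c / d)" unfolding rat_const_divide unfolding v(1) cd rat_const_def ..
  moreover from this nz have "c / d \<noteq> 0" by auto
  ultimately show ?thesis by (rule that)
qed

lemma power_int_sum_exponent: "x \<noteq> 0 \<Longrightarrow> (x :: 'a :: field) powi (\<Sum>i\<in>I. f i) = (\<Prod>i\<in>I. x powi f i)"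
  by (induction I rule: infinite_finite_induct) (simp_all add: power_int_add)

lemma blaschke_on_circle:
  assumes "norm \<alpha> < 1" "norm z = 1"
  shows "rat_eval (blaschke \<alpha>) z = - z * cnj (1 - cnj \<alpha> * z) / (1 - cnj \<alpha> * z)"
    and "regular z (blaschke \<alpha>)"
proof -
  have d: "1 - cnj \<alpha> * z \<noteq> 0" using conj_denominator_nonzero[of \<alpha> z] assms by simp
  have n: "regular z (rat_const \<alpha> - rat_z)" "rat_eval (rat_const \<alpha> - rat_z) z = \<alpha> - z"
    by (simp_all add: ord_ge_diff ord_ge_const rat_eval_diff)
  have "rat_eval (1 - rat_const (cnj \<alpha>) * rat_z) z \<noteq> 0" using d by (simp add: rat_conj_denominator)
  note * = rat_eval_divide_regular[OF n(1) rat_conj_denominator(1) this, folded blaschke_def]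
  have "z * cnj z = 1" using complex_norm_square[of z] assms(2) by simp
  hence "\<alpha> - z = - z * cnj (1 - cnj \<alpha> * z)" by (simp add: algebra_simps)
  thus "rat_eval (blaschke \<alpha>) z = - z * cnj (1 - cnj \<alpha> * z) / (1 - cnj \<alpha> * z)"
    unfolding *(2) n(2) rat_conj_denominator(2) by simp
  show "regular z (blaschke \<alpha>)" by (rule *(1))
qed

text \<open>
  Dividing the Blaschke factors out of \<open>u\<close> leaves a unimodular function without zeros or poles in
  the disk, which is constant.
\<close>

lemma unimodular_factorization:
  assumes uni: "\<And>z. norm z = 1 \<Longrightarrow> norm (rat_eval u z) = 1"
    and S: "finite S" "S \<subseteq> ball 0 1" "\<And>\<alpha>. \<alpha> \<in> ball 0 1 - S \<Longrightarrow> rat_ord \<alpha> u = 0"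
  obtains c where "c \<noteq> 0" "u = rat_const c * (\<Prod>\<alpha>\<in>S. blaschke \<alpha> powi rat_ord \<alpha> u)"
proof -
  have u: "u \<noteq> 0" using uni[of 1] by auto
  define w where "w = (\<Prod>\<alpha>\<in>S. blaschke \<alpha> powi rat_ord \<alpha> u)"
  have w: "w \<noteq> 0" unfolding w_def using S(1) by simp
  have b1: "norm (rat_eval (blaschke \<alpha>) z) = 1" if "norm z = 1" "\<alpha> \<in> S" for z \<alpha>
  proof -
    have "norm \<alpha> < 1" using that S(2) by auto
    moreover from this have "1 - cnj \<alpha> * z \<noteq> 0" using conj_denominator_nonzero[of \<alpha> z] that by simp
    ultimately show ?thesis using that
      by (simp only: blaschke_on_circle norm_divide norm_mult norm_minus_cancel complex_mod_cnj) simp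
  qed
  have rb: "regular z (blaschke \<alpha>)" if "norm z = 1" "\<alpha> \<in> S" for z \<alpha>
    using that S(2) by (auto intro!: regular_blaschke)
  have nb: "rat_eval (blaschke \<alpha>) z \<noteq> 0" if "norm z = 1" "\<alpha> \<in> S" for z \<alpha>
    using b1[OF that] by auto
  have w1: "regular z w" "norm (rat_eval w z) = 1" if "norm z = 1" for z
  proof -
    show "regular z w" unfolding w_def
      by (intro regular_prod rat_eval_power_int(2)) (use rb nb that in auto)
    have "rat_eval w z = (\<Prod>\<alpha>\<in>S. rat_eval (blaschke \<alpha>) z powi rat_ord \<alpha> u)"
      unfolding w_def by (subst rat_eval_prod) (use rb nb that in \<open>auto simp: rat_eval_power_int intro!: prod.cong\<close>)
    thus "norm (rat_eval w z) = 1" using b1[OF that] by (simp add: prod_norm[symmetric] norm_power_int)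
  qed
  have "norm (rat_eval (u / w) z) = 1" if "norm z = 1" for z
  proof -
    have "rat_eval w z \<noteq> 0" using w1(2)[OF that] by auto
    from rat_eval_divide_regular(2)[OF unimodular_regular[OF uni that] w1(1)[OF that] this]
    show ?thesis using w1(2)[OF that] uni[OF that] by (simp add: norm_divide)
  qed
  moreover have "rat_ord z (u / w) = 0" if "norm z < 1" for z
  proof -
    have "rat_ord z w = (\<Sum>\<alpha>\<in>S. rat_ord z (blaschke \<alpha> powi rat_ord \<alpha> u))"
      unfolding w_def by (rule rat_ord_prod) simp
    also have "\<dots> = (\<Sum>\<alpha>\<in>S. if z = \<alpha> then rat_ord z u else 0)"
      by (intro sum.cong refl) (use S that in \<open>auto simp: rat_ord_power_int rat_ord_blaschke subset_iff\<close>)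
    also have "\<dots> = rat_ord z u" using S that by auto
    finally show ?thesis using u w by (simp add: rat_ord_divide)
  qed
  ultimately obtain c where "u / w = rat_const c" "c \<noteq> 0" using unimodular_constant by blast
  hence "u = rat_const c * w" using w by (simp add: field_simps)
  with \<open>c \<noteq> 0\<close> show ?thesis unfolding w_def by (rule that)
qed

text \<open>
  On the circle \<open>b\<^sub>\<alpha>(z) = (\<alpha> - z) / (1 - \<alpha>' z)\<close>, with \<open>\<alpha>'\<close> the conjugate of \<open>\<alpha>\<close>, is a positive
  multiple of \<open>- z / (1 - \<alpha>' z)\<^sup>2\<close>, as \<open>\<alpha> - z\<close> is \<open>- z\<close> times the conjugate of \<open>1 - \<alpha>' z\<close>. Replacing
  each Blaschke factor of \<open>u\<close> in this way leaves a nonnegative power of \<open>z\<close>, by the condition on the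
  orders, and factors without zeros or poles in the closed disk.
\<close>

lemma analytic_positive_multiple:
  assumes uni: "\<And>z. norm z = 1 \<Longrightarrow> norm (rat_eval u z) = 1"
    and S: "finite S" "S \<subseteq> ball 0 1" "\<And>\<alpha>. \<alpha> \<in> ball 0 1 - S \<Longrightarrow> rat_ord \<alpha> u = 0"
    and index: "(\<Sum>\<alpha>\<in>S. rat_ord \<alpha> u) \<ge> 0"
  obtains G where "\<And>z. norm z \<le> 1 \<Longrightarrow> regular z G"
    "\<And>z. norm z = 1 \<Longrightarrow> \<exists>\<rho>>0. rat_eval G z = of_real \<rho> * rat_eval u z"
proof -
  obtain c where c: "c \<noteq> 0" "u = rat_const c * (\<Prod>\<alpha>\<in>S. blaschke \<alpha> powi rat_ord \<alpha> u)"
    using unimodular_factorization[OF uni S] .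
  define k where "k \<alpha> = rat_ord \<alpha> u" for \<alpha>
  define N where "N = (\<Sum>\<alpha>\<in>S. k \<alpha>)"
  define D where "D \<alpha> = 1 - rat_const (cnj \<alpha>) * rat_z" for \<alpha>
  define d where "d \<alpha> z = 1 - cnj \<alpha> * z" for \<alpha> z
  have D: "regular z (D \<alpha>)" "rat_eval (D \<alpha>) z = d \<alpha> z" for \<alpha> z
    unfolding D_def d_def by (rule rat_conj_denominator)+
  have d: "d \<alpha> z \<noteq> 0" if "\<alpha> \<in> S" "norm z \<le> 1" for \<alpha> z
    using conj_denominator_nonzero[of \<alpha> z] that S(2) by (auto simp: d_def)
  \<comment> \<open>\<open>- z E \<alpha>\<close> replaces the Blaschke factor with zero \<open>\<alpha>\<close>.\<close>
  define E where "E \<alpha> = inverse (D \<alpha> * D \<alpha>)" for \<alpha>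
  have E: "regular z (E \<alpha>)" "rat_eval (E \<alpha>) z = inverse (d \<alpha> z * d \<alpha> z)" if "\<alpha> \<in> S" "norm z \<le> 1" for \<alpha> z
    using rat_eval_inverse[of z "D \<alpha> * D \<alpha>"] D d[OF that] unfolding E_def
    by (simp_all add: rat_eval_mult regular_mult del: inverse_mult_distrib)
  define G where "G = rat_const c * ((- rat_z) powi N * (\<Prod>\<alpha>\<in>S. E \<alpha> powi k \<alpha>))"
  have Z: "regular z (- rat_z)" "rat_eval (- rat_z) z = - z" for z by (simp_all add: rat_eval_uminus)
  have pow: "regular z (r ^ n)" if "regular z r" for z r and n :: nat
    using that by (induction n) (auto intro: regular_mult)
  have G: "regular z G" if "norm z \<le> 1" for z
  proof -
    have "regular z ((- rat_z) powi N)" using index Z by (simp add: N_def k_def power_int_def pow)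
    moreover have "regular z (\<Prod>\<alpha>\<in>S. E \<alpha> powi k \<alpha>)"
      by (intro regular_prod rat_eval_power_int(2)) (use E d that in auto)
    ultimately show ?thesis unfolding G_def by (intro regular_mult ord_ge_const)
  qed
  have pos: "\<exists>\<rho>>0. rat_eval G z = of_real \<rho> * rat_eval u z" if z: "norm z = 1" for z
  proof -
    define \<rho> where "\<rho> = (\<Prod>\<alpha>\<in>S. inverse ((norm (d \<alpha> z))\<^sup>2) powi k \<alpha>)"
    have z0: "z \<noteq> 0" using z by auto
    have dz: "d \<alpha> z \<noteq> 0" if "\<alpha> \<in> S" for \<alpha> using d[OF that] z by simp
    have "\<rho> > 0" unfolding \<rho>_def by (rule prod_pos) (use dz in \<open>auto intro!: zero_less_power_int\<close>)
    have b: "regular z (blaschke \<alpha>)" "rat_eval (blaschke \<alpha>) z = - z * cnj (d \<alpha> z) / d \<alpha> z"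
      if "\<alpha> \<in> S" for \<alpha>
      using blaschke_on_circle[of \<alpha> z] that S(2) z by (auto simp: d_def)
    have b0: "rat_eval (blaschke \<alpha>) z \<noteq> 0" if "\<alpha> \<in> S" for \<alpha> using b(2)[OF that] dz[OF that] z0 by simp
    have u: "rat_eval u z = c * (\<Prod>\<alpha>\<in>S. (- z * cnj (d \<alpha> z) / d \<alpha> z) powi k \<alpha>)"
    proof -
      have "rat_eval u z = c * rat_eval (\<Prod>\<alpha>\<in>S. blaschke \<alpha> powi k \<alpha>) z"
        by (subst c(2)) (use b b0 in \<open>simp add: rat_eval_mult ord_ge_const regular_prod rat_eval_power_int k_def\<close>)
      also have "rat_eval (\<Prod>\<alpha>\<in>S. blaschke \<alpha> powi k \<alpha>) z = (\<Prod>\<alpha>\<in>S. (- z * cnj (d \<alpha> z) / d \<alpha> z) powi k \<alpha>)"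
        by (subst rat_eval_prod) (use b b0 in \<open>auto simp: rat_eval_power_int intro!: prod.cong\<close>)
      finally show ?thesis .
    qed
    have "rat_eval G z = c * ((- z) powi N * (\<Prod>\<alpha>\<in>S. inverse (d \<alpha> z * d \<alpha> z) powi k \<alpha>))"
    proof -
      have e: "regular z (E \<alpha>)" "rat_eval (E \<alpha>) z = inverse (d \<alpha> z * d \<alpha> z)" "rat_eval (E \<alpha>) z \<noteq> 0"
        if "\<alpha> \<in> S" for \<alpha> using E[OF that, of z] z dz[OF that] by auto
      have "rat_eval (\<Prod>\<alpha>\<in>S. E \<alpha> powi k \<alpha>) z = (\<Prod>\<alpha>\<in>S. inverse (d \<alpha> z * d \<alpha> z) powi k \<alpha>)"
        by (subst rat_eval_prod) (use e in \<open>auto simp: rat_eval_power_int intro!: prod.cong\<close>)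
      moreover have "regular z (\<Prod>\<alpha>\<in>S. E \<alpha> powi k \<alpha>)"
        by (intro regular_prod rat_eval_power_int(2)) (use e in auto)
      moreover have "rat_eval (- rat_z) z \<noteq> 0" using z0 Z by simp
      ultimately show ?thesis unfolding G_def
        using rat_eval_power_int[OF Z(1), of z N] Z(2)[of z]
        by (simp add: rat_eval_mult regular_mult ord_ge_const)
    qed
    also have "(- z) powi N = (\<Prod>\<alpha>\<in>S. (- z) powi k \<alpha>)"
      unfolding N_def by (rule power_int_sum_exponent) (use z0 in simp)
    also have "(\<Prod>\<alpha>\<in>S. (- z) powi k \<alpha>) * (\<Prod>\<alpha>\<in>S. inverse (d \<alpha> z * d \<alpha> z) powi k \<alpha>)
        = of_real \<rho> * (\<Prod>\<alpha>\<in>S. (- z * cnj (d \<alpha> z) / d \<alpha> z) powi k \<alpha>)"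
      unfolding \<rho>_def of_real_prod prod.distrib[symmetric]
    proof (rule prod.cong[OF refl])
      fix \<alpha> assume "\<alpha> \<in> S"
      have "of_real (inverse ((norm (d \<alpha> z))\<^sup>2) powi k \<alpha>) = inverse (d \<alpha> z * cnj (d \<alpha> z)) powi k \<alpha>"
        by (simp add: of_real_power_int complex_norm_square flip: of_real_power)
      thus "(- z) powi k \<alpha> * inverse (d \<alpha> z * d \<alpha> z) powi k \<alpha>
          = of_real (inverse ((norm (d \<alpha> z))\<^sup>2) powi k \<alpha>) * (- z * cnj (d \<alpha> z) / d \<alpha> z) powi k \<alpha>"
        using dz[OF \<open>\<alpha> \<in> S\<close>] by (simp only: power_int_mult_distrib[symmetric]) (simp add: field_simps)
    qed
    finally have "rat_eval G z = of_real \<rho> * rat_eval u z" by (simp add: u)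
    with \<open>\<rho> > 0\<close> show ?thesis by blast
  qed
  show ?thesis using that[of G] G pos by blast
qed

text \<open>
  Otherwise let \<open>G\<close> be the analytic function of \<open>analytic_positive_multiple\<close>. As \<open>G / u\<close> is positive and
  bounded away from \<open>0\<close> on the circle, a small multiple of \<open>G\<close> is an approximant that is strictly
  better than \<open>0\<close>.
\<close>

lemma badly_approximable_index:
  assumes uni: "\<And>z. norm z = 1 \<Longrightarrow> norm (rat_eval u z) = 1"
    and bad: "badly_approximable (rat_eval u)"
    and S: "finite S" "S \<subseteq> ball 0 1" "\<And>\<alpha>. \<alpha> \<in> ball 0 1 - S \<Longrightarrow> rat_ord \<alpha> u = 0"
  shows "(\<Sum>\<alpha>\<in>S. rat_ord \<alpha> u) < 0"
proof (rule ccontr)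
  assume "\<not> ?thesis"
  then obtain G where G: "\<And>z. norm z \<le> 1 \<Longrightarrow> regular z G"
    "\<And>z. norm z = 1 \<Longrightarrow> \<exists>\<rho>>0. rat_eval G z = of_real \<rho> * rat_eval u z"
    using analytic_positive_multiple[OF uni S] by (metis not_less)
  interpret prob_space circle_measure by (rule prob_space_circle)
  have an: "rat_eval r analytic_on cball 0 1" if "\<And>z. norm z \<le> 1 \<Longrightarrow> regular z r" for r
    using that by (intro rat_eval_analytic) auto
  have "continuous_on (sphere 0 1) (rat_eval G)"
    using an[OF G(1)] by (intro holomorphic_on_imp_continuous_on analytic_imp_holomorphic) (auto elim: analytic_on_subset)
  hence cont: "continuous_on (sphere 0 1) (\<lambda>z. norm (rat_eval G z))" by (rule continuous_on_norm)
  obtain z1 where z1: "norm z1 = 1" "\<And>z. norm z = 1 \<Longrightarrow> norm (rat_eval G z1) \<le> norm (rat_eval G z)"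
    using continuous_attains_inf[OF compact_sphere _ cont] by auto
  obtain z2 where z2: "norm z2 = 1" "\<And>z. norm z = 1 \<Longrightarrow> norm (rat_eval G z) \<le> norm (rat_eval G z2)"
    using continuous_attains_sup[OF compact_sphere _ cont] by auto
  define m M where "m = norm (rat_eval G z1)" and "M = norm (rat_eval G z2)"
  have "m > 0" unfolding m_def using G(2)[OF z1(1)] uni[OF z1(1)] by (auto simp: norm_mult)
  have "m \<le> M" unfolding m_def M_def by (rule z1(2)[OF z2(1)])
  \<comment> \<open>With this factor \<open>H / u\<close> has values in \<open>[m / M, 1]\<close> on the circle.\<close>
  define H where "H = rat_const (of_real (1 / M)) * G"
  have H: "regular z H" "rat_eval H z = of_real (1 / M) * rat_eval G z" if "norm z \<le> 1" for z
    using G(1)[OF that] by (simp_all add: H_def regular_mult ord_ge_const rat_eval_mult)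
  have "rat_eval H \<in> Hinf_circle"
  proof -
    have "((\<lambda>r. rat_eval H (of_real r * \<zeta>)) \<longlongrightarrow> rat_eval H \<zeta>) (at_left (1::real))" if "norm \<zeta> = 1" for \<zeta>
    proof -
      have "rat_eval H analytic_on {\<zeta>}" using that by (intro rat_eval_analytic) (auto intro: H)
      hence "isCont (rat_eval H) \<zeta>" by (rule analytic_at_imp_isCont)
      moreover have "((\<lambda>r. of_real r * \<zeta>) \<longlongrightarrow> of_real 1 * \<zeta>) (at_left (1::real))"
        by (intro tendsto_intros)
      ultimately show ?thesis using isCont_tendsto_compose by fastforce
    qed
    moreover have "rat_eval H \<in> Hinf" using H by (intro regular_Hinf) auto
    ultimately show ?thesis unfolding Hinf_circle_def using AE_circle
      by (auto intro!: bexI[of _ "rat_eval H"] elim!: eventually_mono)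
  qed
  have "Linf_norm (\<lambda>\<zeta>. rat_eval u \<zeta> - rat_eval H \<zeta>) \<le> ennreal (1 - m / M)"
    unfolding Linf_norm_def
  proof (rule esssup_I)
    show "AE \<zeta> in circle_measure. ennreal (norm (rat_eval u \<zeta> - rat_eval H \<zeta>)) \<le> ennreal (1 - m / M)"
      using AE_circle
    proof eventually_elim
      case (elim \<zeta>)
      then obtain \<rho> where \<rho>: "\<rho> > 0" "rat_eval G \<zeta> = of_real \<rho> * rat_eval u \<zeta>" using G(2) by blast
      have "norm (rat_eval G \<zeta>) = \<rho>" using \<rho> uni[OF elim] by (simp add: norm_mult)
      hence le: "m \<le> \<rho>" "\<rho> \<le> M" using z1(2)[OF elim] z2(2)[OF elim] by (simp_all add: m_def M_def)
      have "rat_eval u \<zeta> - rat_eval H \<zeta> = of_real (1 - \<rho> / M) * rat_eval u \<zeta>"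
        using H(2)[of \<zeta>] elim \<rho>(2) by (simp add: algebra_simps)
      hence "norm (rat_eval u \<zeta> - rat_eval H \<zeta>) = \<bar>1 - \<rho> / M\<bar>" using uni[OF elim] by (simp only: norm_mult norm_of_real) simp
      also have "\<dots> \<le> 1 - m / M" using le \<open>m > 0\<close> by (simp add: divide_simps)
      finally show ?case by (rule ennreal_leI)
    qed
  qed measurable
  note upper = this
  have "Linf_norm (rat_eval u) = 1"
  proof -
    have "esssup circle_measure (\<lambda>\<zeta>. ennreal (norm (rat_eval u \<zeta>))) = esssup circle_measure (\<lambda>\<zeta>. 1)"
      by (rule esssup_AE_cong) (use AE_circle uni in \<open>auto elim!: eventually_mono\<close>)
    also have "\<dots> = 1" by (rule esssup_const) (simp add: emeasure_space_1[simplified])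
    finally show ?thesis by (simp add: Linf_norm_def)
  qed
  moreover have "(INF g\<in>Hinf_circle. Linf_norm (\<lambda>\<zeta>. rat_eval u \<zeta> - g \<zeta>)) \<le> Linf_norm (\<lambda>\<zeta>. rat_eval u \<zeta> - rat_eval H \<zeta>)"
    using \<open>rat_eval H \<in> Hinf_circle\<close> by (rule INF_lower)
  ultimately have "1 \<le> Linf_norm (\<lambda>\<zeta>. rat_eval u \<zeta> - rat_eval H \<zeta>)"
    using bad unfolding badly_approximable_def by simp
  hence "1 \<le> ennreal (1 - m / M)" using upper by (rule order_trans)
  hence "1 \<le> 1 - m / M" by (simp add: ennreal_1[symmetric] ennreal_le_iff2 del: ennreal_1)
  thus False using \<open>m > 0\<close> \<open>m \<le> M\<close> by (simp add: divide_simps)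
qed

section \<open>McMillan degrees of the Riesz projections\<close>

lemma regular_imp_no_pole: "regular z r \<Longrightarrow> \<not> is_pole (rat_eval r) z"
  by (intro analytic_at_imp_no_pole rat_eval_analytic) auto

text \<open>
  The limit of \<open>q\<close> at infinity is the value of the reflected function at \<open>0\<close>.
\<close>

lemma bounded_at_infinity:
  assumes reg: "\<And>z. norm z \<ge> 1 \<Longrightarrow> regular z q" and flat: "regular 0 (rat_flat q)"
  shows "\<not> filterlim (rat_eval q) at_infinity at_infinity"
proof
  assume inf: "filterlim (rat_eval q) at_infinity at_infinity"
  have "isCont (rat_eval (rat_flat q)) 0"
    by (intro analytic_at_imp_isCont rat_eval_analytic) (use flat in auto)
  hence "((\<lambda>z. rat_eval (rat_flat q) (inverse z)) \<longlongrightarrow> rat_eval (rat_flat q) 0) at_infinity"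
    using tendsto_inverse_0 by (rule isCont_tendsto_compose)
  moreover have "\<forall>\<^sub>F z in at_infinity. rat_eval (rat_flat q) (inverse z) = rat_eval q z"
    unfolding eventually_at_infinity
  proof (intro exI[of _ 1] allI impI)
    fix z :: complex assume "1 \<le> norm z"
    moreover from this have "z \<noteq> 0" by auto
    ultimately show "rat_eval (rat_flat q) (inverse z) = rat_eval q z"
      using rat_eval_flat_regular[of "inverse z" q] reg[of z] by (simp add: inverse_eq_divide)
  qed
  ultimately have "(rat_eval q \<longlongrightarrow> rat_eval (rat_flat q) 0) at_infinity"
    by (rule Lim_transform_eventually)
  thus False using not_tendsto_and_filterlim_at_infinity[OF trivial_limit_at_infinity _ inf] by blast
qed

lemma map_matrix_nth [simp]: "map_matrix f M $ i $ j = f (M $ i $ j)"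
  by (simp add: map_matrix_def)

lemma sum_pole_mult_le_mcmillan_minus:
  fixes \<Phi> :: "ratfun ^ 'n ^ 'n"
  assumes circle: "\<And>z i j. norm z = 1 \<Longrightarrow> regular z (\<Phi> $ i $ j)" and S: "finite S" "S \<subseteq> ball 0 1"
  shows "(\<Sum>\<alpha>\<in>S. pole_mult \<alpha> (map_matrix riesz_minus \<Phi>)) \<le> mcmillan_degree (map_matrix riesz_minus \<Phi>)"
proof -
  have out: "regular z (riesz_minus (\<Phi> $ i $ j))" if "norm z \<ge> 1" for z i j
    by (rule riesz_projections(2)) (use circle that in auto)
  have flat: "regular z (rat_flat (riesz_minus (\<Phi> $ i $ j)))" if "norm z \<le> 1" for z i j
    by (rule riesz_projections(3)) (use circle that in auto)
  have "poles_in_disk (map_matrix riesz_minus \<Phi>)"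
    unfolding poles_in_disk_def
  proof (intro allI conjI impI)
    fix i j z assume "is_pole (rat_eval (map_matrix riesz_minus \<Phi> $ i $ j)) z"
    hence "\<not> norm z \<ge> 1" using out[of z i j] regular_imp_no_pole by auto
    thus "z \<in> ball 0 1" by simp
  next
    fix i j show "\<not> filterlim (rat_eval (map_matrix riesz_minus \<Phi> $ i $ j)) at_infinity at_infinity"
      unfolding map_matrix_nth by (rule bounded_at_infinity) (use out flat in auto)
  qed
  hence "mcmillan_degree (map_matrix riesz_minus \<Phi>) = bp_degree (map_matrix riesz_minus \<Phi>)"
    by (simp add: mcmillan_degree_def)
  thus ?thesis using sum_pole_mult_le_bp_degree[OF _ S, of "map_matrix riesz_minus \<Phi>"] out by simp
qed

lemma riesz_sum: "riesz_minus r + riesz_plus r = r"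
  by (simp add: riesz_minus_def)

lemma sum_pole_mult_le_mcmillan_minus_2:
  fixes \<Phi> :: "ratfun ^ 2 ^ 2"
  assumes circle: "\<And>z i j. norm z = 1 \<Longrightarrow> regular z (\<Phi> $ i $ j)" and S: "finite S" "S \<subseteq> ball 0 1"
  shows "(\<Sum>\<alpha>\<in>S. pole_mult \<alpha> \<Phi>) \<le> mcmillan_degree (map_matrix riesz_minus \<Phi>)"
proof -
  have "\<Phi> = map_matrix riesz_minus \<Phi> + map_matrix riesz_plus \<Phi>"
    by (simp add: vec_eq_iff riesz_sum)
  moreover have "regular \<alpha> (map_matrix riesz_plus \<Phi> $ i $ j)" if "\<alpha> \<in> S" for \<alpha> i j
    unfolding map_matrix_nth by (rule riesz_projections(1)) (use circle S that in auto)
  ultimately have "pole_mult \<alpha> \<Phi> \<le> pole_mult \<alpha> (map_matrix riesz_minus \<Phi>)" if "\<alpha> \<in> S" for \<alpha>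
    using pole_mult_add_regular[of \<alpha> "map_matrix riesz_plus \<Phi>" "map_matrix riesz_minus \<Phi>"] that by simp
  hence "(\<Sum>\<alpha>\<in>S. pole_mult \<alpha> \<Phi>) \<le> (\<Sum>\<alpha>\<in>S. pole_mult \<alpha> (map_matrix riesz_minus \<Phi>))"
    by (rule sum_mono)
  also have "\<dots> \<le> mcmillan_degree (map_matrix riesz_minus \<Phi>)"
    using circle S by (rule sum_pole_mult_le_mcmillan_minus)
  finally show ?thesis .
qed

lemma pole_mult_1_le_iff: "pole_mult \<alpha> ((\<chi> i j. r) :: ratfun ^ 1 ^ 1) \<le> n \<longleftrightarrow> ord_ge \<alpha> (- int n) r"
  by (simp add: pole_mult_le_iff mat_ord_ge_def det_1)

lemma sum_pole_mult_le_mcmillan_minus_1: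
  assumes circle: "\<And>z. norm z = 1 \<Longrightarrow> regular z r" and S: "finite S" "S \<subseteq> ball 0 1"
  shows "(\<Sum>\<alpha>\<in>S. pole_mult \<alpha> ((\<chi> i j. r) :: ratfun ^ 1 ^ 1))
    \<le> mcmillan_degree ((\<chi> i j. riesz_minus r) :: ratfun ^ 1 ^ 1)"
proof -
  have eq: "((\<chi> i j. riesz_minus r) :: ratfun ^ 1 ^ 1) = map_matrix riesz_minus (\<chi> i j. r)"
    by (simp add: vec_eq_iff)
  have "pole_mult \<alpha> ((\<chi> i j. r) :: ratfun ^ 1 ^ 1) \<le> pole_mult \<alpha> ((\<chi> i j. riesz_minus r) :: ratfun ^ 1 ^ 1)"
    if "\<alpha> \<in> S" for \<alpha>
  proof -
    define n where "n = pole_mult \<alpha> ((\<chi> i j. riesz_minus r) :: ratfun ^ 1 ^ 1)"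
    have "ord_ge \<alpha> (- int n) (riesz_minus r)" unfolding pole_mult_1_le_iff[symmetric] n_def ..
    moreover have "regular \<alpha> (riesz_plus r)"
      by (rule riesz_projections(1)) (use circle S that in auto)
    hence "ord_ge \<alpha> (- int n) (riesz_plus r)" by (rule ord_ge_mono) simp
    ultimately have "ord_ge \<alpha> (- int n) (riesz_minus r + riesz_plus r)" by (rule ord_ge_add)
    thus ?thesis unfolding riesz_sum pole_mult_1_le_iff[symmetric] n_def .
  qed
  hence "(\<Sum>\<alpha>\<in>S. pole_mult \<alpha> ((\<chi> i j. r) :: ratfun ^ 1 ^ 1))
      \<le> (\<Sum>\<alpha>\<in>S. pole_mult \<alpha> ((\<chi> i j. riesz_minus r) :: ratfun ^ 1 ^ 1))"
    by (rule sum_mono)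
  also have "\<dots> \<le> mcmillan_degree ((\<chi> i j. riesz_minus r) :: ratfun ^ 1 ^ 1)"
    unfolding eq by (rule sum_pole_mult_le_mcmillan_minus) (use circle S in auto)
  finally show ?thesis .
qed

lemma pole_mult_flat_eq_sharp:
  fixes \<Phi> :: "ratfun ^ 2 ^ 2"
  shows "pole_mult (cnj \<alpha>) (map_matrix rat_flat \<Phi>) = pole_mult \<alpha> (map_matrix rat_sharp \<Phi>)"
proof -
  have "det (map_matrix rat_flat \<Phi>) = rat_flat (det \<Phi>)"
    by (simp only: det_2 map_matrix_nth diff_conv_add_uminus rat_flat_add rat_flat_mult rat_flat_uminus)
  moreover have "det (map_matrix rat_sharp \<Phi>) = rat_sharp (det \<Phi>)"
    by (simp only: det_2 map_matrix_nth diff_conv_add_uminus rat_sharp_add rat_sharp_mult rat_sharp_uminus)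
  ultimately have "mat_ord_ge (cnj \<alpha>) k (map_matrix rat_flat \<Phi>) \<longleftrightarrow> mat_ord_ge \<alpha> k (map_matrix rat_sharp \<Phi>)" for k
    by (simp add: mat_ord_ge_def ord_ge_flat_iff_sharp)
  thus ?thesis by (simp add: pole_mult_def)
qed

text \<open>
  The reflected antianalytic part has no poles in the disk, so there the poles of the reflected
  analytic part are those of the reflected \<open>\<Phi>\<close>.
\<close>

lemma mcmillan_plus_le_sum_pole_mult_sharp:
  fixes \<Phi> :: "ratfun ^ 2 ^ 2"
  assumes circle: "\<And>z i j. norm z = 1 \<Longrightarrow> regular z (\<Phi> $ i $ j)" and S: "finite S" "S \<subseteq> ball 0 1"
    and out: "\<And>\<alpha>. \<alpha> \<in> ball 0 1 - S \<Longrightarrow> pole_mult \<alpha> (map_matrix rat_sharp \<Phi>) = 0"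
  shows "mcmillan_degree (map_matrix riesz_plus \<Phi>) \<le> (\<Sum>\<alpha>\<in>S. pole_mult \<alpha> (map_matrix rat_sharp \<Phi>))"
proof -
  define Q where "Q = map_matrix riesz_plus \<Phi>"
  have Q: "regular z (Q $ i $ j)" if "norm z \<le> 1" for z i j
    unfolding Q_def map_matrix_nth by (rule riesz_projections(1)) (use circle that in auto)
  show ?thesis
  proof (cases "poles_in_disk Q")
    case True
    have "\<forall>i j. rat_eval ((Q ** mat 1) $ i $ j) \<in> Hinf"
      using Q by (auto intro!: regular_Hinf simp: matrix_mul_rid)
    hence "bp_degree Q \<le> 0" unfolding bp_degree_def using blaschke_potapov_one by (intro Least_le) blast
    thus ?thesis using True by (simp add: mcmillan_degree_def Q_def)
  next
    case False
    have le: "pole_mult (cnj \<alpha>) (map_matrix rat_flat Q) \<le> pole_mult \<alpha> (map_matrix rat_sharp \<Phi>)"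
      if "norm \<alpha> < 1" for \<alpha>
    proof -
      have "map_matrix rat_flat Q = map_matrix rat_flat \<Phi> + map_matrix (\<lambda>r. - rat_flat (riesz_minus r)) \<Phi>"
        by (simp add: vec_eq_iff Q_def rat_flat_uminus[symmetric] rat_flat_add[symmetric] riesz_minus_def)
      moreover have "regular (cnj \<alpha>) (map_matrix (\<lambda>r. - rat_flat (riesz_minus r)) \<Phi> $ i $ j)" for i j
        unfolding map_matrix_nth ord_ge_uminus by (rule riesz_projections(3)) (use circle that in auto)
      ultimately have "pole_mult (cnj \<alpha>) (map_matrix rat_flat Q) \<le> pole_mult (cnj \<alpha>) (map_matrix rat_flat \<Phi>)"
        using pole_mult_add_regular by metis
      thus ?thesis by (simp only: pole_mult_flat_eq_sharp)
    qed
    have "no_poles_in_cdisk Q" unfolding no_poles_in_cdisk_def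
      using Q regular_imp_no_pole by auto
    hence "mcmillan_degree Q = bp_degree (map_matrix rat_flat Q)" using False by (simp add: mcmillan_degree_def)
    also have "\<dots> \<le> (\<Sum>\<alpha>\<in>cnj ` S. pole_mult \<alpha> (map_matrix rat_flat Q))"
    proof (rule bp_degree_le)
      show "finite (cnj ` S)" "cnj ` S \<subseteq> ball 0 1" using S by auto
      fix \<alpha> assume "\<alpha> \<in> ball 0 1 - cnj ` S"
      hence "norm (cnj \<alpha>) < 1" "cnj \<alpha> \<notin> S" by (auto simp: image_iff)
      thus "pole_mult \<alpha> (map_matrix rat_flat Q) = 0" using le[of "cnj \<alpha>"] out[of "cnj \<alpha>"] by simp
    next
      fix z :: complex and i j assume "norm z = 1"
      thus "regular z (map_matrix rat_flat Q $ i $ j)"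
        unfolding map_matrix_nth by (intro rat_flat_circle(1) Q) auto
    qed
    also have "\<dots> = (\<Sum>\<alpha>\<in>S. pole_mult (cnj \<alpha>) (map_matrix rat_flat Q))"
      by (simp add: sum.reindex inj_on_def)
    also have "\<dots> \<le> (\<Sum>\<alpha>\<in>S. pole_mult \<alpha> (map_matrix rat_sharp \<Phi>))"
      by (intro sum_mono le) (use S in auto)
    finally show ?thesis by (simp only: Q_def)
  qed
qed

section \<open>The family of symbols\<close>

lemma inner_regular:
  assumes "inner_coouter_column v" "norm z \<le> 1"
  shows "regular z (v $ i)"
  using assms Hinf_regular exhaust_2[of i] unfolding inner_coouter_column_def by metis

lemma inner_mult_sharp:
  assumes "inner_coouter_column v"
  shows "rat_sharp (v $ 1) * v $ 1 + rat_sharp (v $ 2) * v $ 2 = 1"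
proof (rule ratfun_eqI_circle)
  show "\<forall>\<^sub>F z in circle_cofinite. rat_eval (rat_sharp (v $ 1) * v $ 1 + rat_sharp (v $ 2) * v $ 2) z = rat_eval 1 z"
    using eventually_circle_norm eventually_rat_eval_sharp[of "v $ 1"] eventually_rat_eval_sharp[of "v $ 2"]
  proof eventually_elim
    case (elim z)
    have "rat_eval (rat_sharp (v $ 1) * v $ 1 + rat_sharp (v $ 2) * v $ 2) z
        = rat_eval (v $ 1) z * cnj (rat_eval (v $ 1) z) + rat_eval (v $ 2) z * cnj (rat_eval (v $ 2) z)"
      using elim by (simp add: rat_eval_add rat_eval_mult regular_mult mult.commute)
    also have "\<dots> = of_real ((norm (rat_eval (v $ 1) z))\<^sup>2 + (norm (rat_eval (v $ 2) z))\<^sup>2)"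
      unfolding of_real_add by (simp only: complex_norm_square)
    also have "\<dots> = 1" using assms elim(1) unfolding inner_coouter_column_def by simp
    finally show ?case by simp
  qed
qed

lemma Psi_nth:
  "Psi u0 u1 v w t $ i $ j = u0 * (rat_sharp (w $ i) * rat_sharp (v $ j))
    + rat_const (of_real t) * (u1 * (complement_column w $ i * complement_column v $ j))"
  by (simp add: Psi_def matrix_matrix_mult_def sum_2 transpose_def sharp_vec_def algebra_simps)

lemma complement_nth [simp]:
  "complement_column v $ 1 = - v $ 2" "complement_column v $ 2 = v $ 1"
  by (simp_all add: complement_column_def)

lemma det_Psi:
  assumes "inner_coouter_column v" "inner_coouter_column w"
  shows "det (Psi u0 u1 v w t) = rat_const (of_real t) * (u0 * u1)"
  using inner_mult_sharp[OF assms(1)] inner_mult_sharp[OF assms(2)]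
  unfolding det_2 Psi_nth complement_nth by algebra

text \<open>
  The adjoint of \<open>\<Psi>\<^sub>t\<close> is \<open>V diag(u\<^sub>0\<^sup>#, t u\<^sub>1\<^sup>#) W\<close> with \<open>V\<close> and \<open>W\<close> inverse to the right and the left
  outer factor, and \<open>t u\<^sub>1\<^sup>#\<close> is the inverse of \<open>u\<^sub>1 / t\<close>.
\<close>

lemma Psi_mult_sharp:
  assumes inner: "inner_coouter_column v" "inner_coouter_column w"
    and u: "u0 * rat_sharp u0 = 1" "u1 * rat_sharp u1 = 1" and t: "t \<noteq> 0"
  shows "Psi u0 u1 v w (1 / t) ** transpose (map_matrix rat_sharp (Psi u0 u1 v w t)) = mat 1"
proof -
  have c: "rat_const (of_real (1 / t)) * rat_const (of_real t) = 1"
    using t by (simp flip: rat_const_hom)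
  have sharp: "rat_sharp (Psi u0 u1 v w t $ i $ j) = rat_sharp u0 * (w $ i * v $ j)
    + rat_const (of_real t) * (rat_sharp u1 * (rat_sharp (complement_column w $ i) * rat_sharp (complement_column v $ j)))" for i j
    by (simp add: Psi_nth rat_sharp_add rat_sharp_mult rat_sharp_const)
  note rel = inner_mult_sharp[OF inner(1)] inner_mult_sharp[OF inner(2)] u c
  have "Psi u0 u1 v w (1 / t) $ i $ 1 * rat_sharp (Psi u0 u1 v w t $ k $ 1)
      + Psi u0 u1 v w (1 / t) $ i $ 2 * rat_sharp (Psi u0 u1 v w t $ k $ 2) = (if i = k then 1 else 0)" for i k :: 2
  proof -
    consider "i = 1" "k = 1" | "i = 1" "k = 2" | "i = 2" "k = 1" | "i = 2" "k = 2"
      using exhaust_2[of i] exhaust_2[of k] by blast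
    thus ?thesis
    proof cases
      case 1
      show ?thesis unfolding 1 sharp unfolding Psi_nth complement_nth rat_sharp_uminus using rel by simp algebra
    next
      case 2
      show ?thesis unfolding 2 sharp unfolding Psi_nth complement_nth rat_sharp_uminus using rel by simp algebra
    next
      case 3
      show ?thesis unfolding 3 sharp unfolding Psi_nth complement_nth rat_sharp_uminus using rel by simp algebra
    next
      case 4
      show ?thesis unfolding 4 sharp unfolding Psi_nth complement_nth rat_sharp_uminus using rel by simp algebra
    qed
  qed
  thus ?thesis
    by (simp add: vec_eq_iff matrix_matrix_mult_def transpose_def sum_2 mat_def)
qed

text \<open>
  \<open>\<Psi>\<^sub>s\<close> is an affine combination of \<open>\<Psi>\<^sub>t\<close> and \<open>\<Psi>\<^sub>t\<^sub>'\<close>, and its determinant a constant multiple of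
  that of \<open>\<Psi>\<^sub>t\<close>.
\<close>

lemma pole_mult_Psi_combination:
  assumes inner: "inner_coouter_column v" "inner_coouter_column w" and t: "t \<noteq> t'" "t \<noteq> 0"
  shows "pole_mult \<alpha> (Psi u0 u1 v w s) \<le> max (pole_mult \<alpha> (Psi u0 u1 v w t)) (pole_mult \<alpha> (Psi u0 u1 v w t'))"
    (is "_ \<le> ?n")
proof -
  define c where "c = (s - t') / (t - t')"
  have cs: "c * t + (1 - c) * t' = s"
  proof -
    have "c * t + (1 - c) * t' = c * (t - t') + t'" by (simp add: algebra_simps)
    thus ?thesis using t by (simp add: c_def)
  qed
  have le: "mat_ord_ge \<alpha> (- int ?n) (Psi u0 u1 v w t)" "mat_ord_ge \<alpha> (- int ?n) (Psi u0 u1 v w t')"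
    unfolding pole_mult_le_iff[symmetric] by (rule max.cobounded1, rule max.cobounded2)
  have "Psi u0 u1 v w s $ i $ j = rat_const (of_real c) * Psi u0 u1 v w t $ i $ j
      + rat_const (of_real (1 - c)) * Psi u0 u1 v w t' $ i $ j" for i j
  proof -
    have "rat_const (of_real s) = rat_const (of_real c) * rat_const (of_real t) + (1 - rat_const (of_real c)) * rat_const (of_real t')"
      unfolding cs[symmetric] by (simp add: rat_const_hom)
    moreover have "rat_const (of_real (1 - c)) = 1 - rat_const (of_real c)" by (simp add: rat_const_hom)
    ultimately show ?thesis unfolding Psi_nth by algebra
  qed
  moreover have "det (Psi u0 u1 v w s) = rat_const (of_real (s / t)) * det (Psi u0 u1 v w t)"
    unfolding det_Psi[OF inner] using t by (simp flip: rat_const_hom mult.assoc)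
  ultimately have "mat_ord_ge \<alpha> (- int ?n) (Psi u0 u1 v w s)"
    using le by (auto simp: mat_ord_ge_def intro!: ord_ge_add ord_ge_cmult)
  thus ?thesis by (simp only: pole_mult_le_iff)
qed

text \<open>
  \<open>\<Psi>\<^sub>s - \<Psi>\<^sub>t\<close> is \<open>(s - t) u\<^sub>1\<close> times a matrix that is analytic in the disk, while the determinant
  again changes only by a constant factor.
\<close>

lemma pole_mult_Psi_change:
  assumes inner: "inner_coouter_column v" "inner_coouter_column w" and t: "t \<noteq> 0"
    and \<alpha>: "norm \<alpha> \<le> 1" and u1: "ord_ge \<alpha> (- int n) u1"
  shows "pole_mult \<alpha> (Psi u0 u1 v w s) \<le> max (pole_mult \<alpha> (Psi u0 u1 v w t)) n" (is "_ \<le> ?n")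
proof -
  have le: "mat_ord_ge \<alpha> (- int ?n) (Psi u0 u1 v w t)"
    unfolding pole_mult_le_iff[symmetric] by (rule max.cobounded1)
  have "regular \<alpha> (complement_column x $ i)" if "inner_coouter_column x" for x i
    using inner_regular[OF that \<alpha>] exhaust_2[of i] by auto
  hence "ord_ge \<alpha> (- int n + 0) (u1 * (complement_column w $ i * complement_column v $ j))" for i j
    by (intro ord_ge_mult u1 regular_mult) (use inner in auto)
  hence "ord_ge \<alpha> (- int ?n) (u1 * (complement_column w $ i * complement_column v $ j))" for i j
    by (rule ord_ge_mono) simp
  moreover have "Psi u0 u1 v w s $ i $ j = Psi u0 u1 v w t $ i $ j
      + rat_const (of_real (s - t)) * (u1 * (complement_column w $ i * complement_column v $ j))" for i j
    unfolding Psi_nth by (simp add: rat_const_hom left_diff_distrib)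
  moreover have "det (Psi u0 u1 v w s) = rat_const (of_real (s / t)) * det (Psi u0 u1 v w t)"
    unfolding det_Psi[OF inner] using t by (simp flip: rat_const_hom mult.assoc)
  ultimately have "mat_ord_ge \<alpha> (- int ?n) (Psi u0 u1 v w s)"
    using le by (auto simp: mat_ord_ge_def intro!: ord_ge_add ord_ge_cmult)
  thus ?thesis by (simp only: pole_mult_le_iff)
qed

text \<open>
  If both \<open>t\<close> and \<open>t'\<close> gave positive terms, the larger of \<open>f t\<close> and \<open>f t'\<close> would contradict the
  first condition. The single positive term is at most \<open>n\<close> by the second one.
\<close>

lemma sum_reciprocal_excess:
  fixes f :: "real \<Rightarrow> nat"
  assumes "finite F" and comb: "\<And>s t t'. t \<in> F \<Longrightarrow> t' \<in> F \<Longrightarrow> t \<noteq> t' \<Longrightarrow> f s \<le> max (f t) (f t')"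
    and change: "\<And>s t. t \<in> F \<Longrightarrow> f s \<le> max (f t) n"
  shows "(\<Sum>t\<in>F. max 0 (int (f (1 / t)) - int (f t))) \<le> int n"
proof (cases "\<exists>t\<in>F. f (1 / t) > f t")
  case True
  then obtain t where t: "t \<in> F" "f (1 / t) > f t" by blast
  have "f (1 / t') \<le> f t'" if "t' \<in> F" "t' \<noteq> t" for t'
  proof (cases "f t \<le> f t'")
    case True
    thus ?thesis using comb[of t t' "1 / t'"] t that by auto
  next
    case False
    thus ?thesis using comb[of t t' "1 / t"] t that by auto
  qed
  hence "(\<Sum>t'\<in>F. max 0 (int (f (1 / t')) - int (f t'))) = (\<Sum>t'\<in>F. if t' = t then int (f (1 / t)) - int (f t) else 0)"
    using t by (intro sum.cong) auto
  also have "\<dots> = int (f (1 / t)) - int (f t)" using t assms(1) by simp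
  also have "\<dots> \<le> int n" using change[of t "1 / t"] t by auto
  finally show ?thesis .
next
  case False
  hence "(\<Sum>t\<in>F. max 0 (int (f (1 / t)) - int (f t))) = 0" by (intro sum.neutral) auto
  thus ?thesis by simp
qed

lemma pole_mult_eq_0: "(\<And>i j. regular \<alpha> (\<Phi> $ i $ j)) \<Longrightarrow> pole_mult \<alpha> \<Phi> = 0" for \<Phi> :: "ratfun ^ 'n ^ 'n"
  using pole_mult_le_iff[of \<alpha> \<Phi> 0] by (simp add: mat_ord_ge_def regular_det)

lemma finite_rat_ord_nonzero: "r \<noteq> 0 \<Longrightarrow> finite {\<alpha>. rat_ord \<alpha> r \<noteq> 0}"
  by (rule finite_subset[of _ "{\<alpha>. \<not> regular \<alpha> r} \<union> {\<alpha>. rat_eval r \<alpha> = 0}"])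
    (auto simp: rat_ord_eq_0_iff finite_nonregular finite_rat_zeros)

lemma finite_pole_mult_nonzero:
  fixes \<Phi> :: "ratfun ^ 'n ^ 'n"
  shows "finite {\<alpha>. pole_mult \<alpha> \<Phi> \<noteq> 0}"
proof (rule finite_subset)
  show "{\<alpha>. pole_mult \<alpha> \<Phi> \<noteq> 0} \<subseteq> (\<Union>i. \<Union>j. {\<alpha>. \<not> regular \<alpha> (\<Phi> $ i $ j)})"
    using pole_mult_eq_0 by fastforce
qed (auto intro: finite_nonregular)

theorem theorem3p6:
  fixes u0 u1 :: ratfun and v w :: "ratfun ^ 2"
  assumes "\<forall>z\<in>sphere 0 1. norm (rat_eval u0 z) = 1"
    and "\<forall>z\<in>sphere 0 1. norm (rat_eval u1 z) = 1"
    and "badly_approximable (rat_eval u0)"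
    and "badly_approximable (rat_eval u1)"
    and "inner_coouter_column v"
    and "inner_coouter_column w"
  shows "(\<Sum>\<^sub>\<infinity>t\<in>{0<..1::real}. ennreal (max 0
            (real (mcmillan_degree (map_matrix riesz_plus (Psi u0 u1 v w t))) + 2
             - real (mcmillan_degree (map_matrix riesz_minus (Psi u0 u1 v w t))))))
         \<le> ennreal (real (mcmillan_degree ((\<chi> i j. riesz_minus u1) :: ratfun ^ 1 ^ 1)))"
proof (rule infsum_le_finite_sums)
  define d_plus where "d_plus t = mcmillan_degree (map_matrix riesz_plus (Psi u0 u1 v w t))" for t
  define d_minus where "d_minus t = mcmillan_degree (map_matrix riesz_minus (Psi u0 u1 v w t))" for t
  define d where "d = mcmillan_degree ((\<chi> i j. riesz_minus u1) :: ratfun ^ 1 ^ 1)"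
  have uni: "\<And>z. norm z = 1 \<Longrightarrow> norm (rat_eval u0 z) = 1" "\<And>z. norm z = 1 \<Longrightarrow> norm (rat_eval u1 z) = 1"
    using assms(1,2) by auto
  note inner = assms(5,6)
  have us: "u0 * rat_sharp u0 = 1" "u1 * rat_sharp u1 = 1" using uni by (blast intro: unimodular_mult_sharp)+
  hence u_nz: "u0 \<noteq> 0" "u1 \<noteq> 0" by auto
  have circle: "regular z (Psi u0 u1 v w t $ i $ j)" if "norm z = 1" for z i j t
  proof -
    have x: "regular z (x $ i)" "regular z (rat_sharp (x $ i))" "regular z (complement_column x $ i)"
      if "inner_coouter_column x" for x and i :: 2
      using inner_regular[OF that, of z] rat_sharp_circle(1)[OF \<open>norm z = 1\<close>] \<open>norm z = 1\<close> exhaust_2[of i] by auto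
    show ?thesis unfolding Psi_nth
      by (intro ord_ge_add regular_mult ord_ge_const x inner unimodular_regular uni that)
  qed
  fix F :: "real set" assume F: "finite F" "F \<subseteq> {0<..1}"
  \<comment> \<open>Finitely many points suffice once the finite set \<open>F\<close> of parameters is fixed.\<close>
  define S where "S = ball 0 1 \<inter> ({\<alpha>. rat_ord \<alpha> u0 \<noteq> 0} \<union> {\<alpha>. rat_ord \<alpha> u1 \<noteq> 0}
    \<union> (\<Union>t\<in>F. {\<alpha>. pole_mult \<alpha> (map_matrix rat_sharp (Psi u0 u1 v w t)) \<noteq> 0}))"
  have S: "finite S" "S \<subseteq> ball 0 1"
    unfolding S_def by (intro finite_Int disjI2 finite_UnI finite_UN_I F(1) finite_rat_ord_nonzero
        finite_pole_mult_nonzero u_nz, blast)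
  define f where "f \<alpha> t = pole_mult \<alpha> (Psi u0 u1 v w t)" for \<alpha> t
  define n where "n \<alpha> = pole_mult \<alpha> ((\<chi> i j. u1) :: ratfun ^ 1 ^ 1)" for \<alpha>
  have index: "(\<Sum>\<alpha>\<in>S. rat_ord \<alpha> u0) \<le> -1" "(\<Sum>\<alpha>\<in>S. rat_ord \<alpha> u1) \<le> -1"
    using badly_approximable_index[OF uni(1) assms(3) S] badly_approximable_index[OF uni(2) assms(4) S]
    by (force simp: S_def)+
  have excess: "max 0 (int (d_plus t) + 2 - int (d_minus t)) \<le> (\<Sum>\<alpha>\<in>S. max 0 (int (f \<alpha> (1 / t)) - int (f \<alpha> t)))"
    if t: "t \<in> F" for t
  proof -
    have t0: "t \<noteq> 0" using t F(2) by auto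
    have "d_plus t \<le> (\<Sum>\<alpha>\<in>S. pole_mult \<alpha> (map_matrix rat_sharp (Psi u0 u1 v w t)))"
      unfolding d_plus_def by (rule mcmillan_plus_le_sum_pole_mult_sharp) (use circle S t in \<open>auto simp: S_def\<close>)
    hence "int (d_plus t) \<le> (\<Sum>\<alpha>\<in>S. int (pole_mult \<alpha> (map_matrix rat_sharp (Psi u0 u1 v w t))))"
      by (simp flip: of_nat_sum)
    also have "\<dots> \<le> (\<Sum>\<alpha>\<in>S. int (f \<alpha> (1 / t)) + (rat_ord \<alpha> u0 + rat_ord \<alpha> u1))"
    proof (rule sum_mono)
      fix \<alpha>
      have "rat_ord \<alpha> (det (Psi u0 u1 v w (1 / t))) = rat_ord \<alpha> u0 + rat_ord \<alpha> u1"
        unfolding det_Psi[OF inner] using t0 u_nz by (simp add: rat_ord_mult rat_ord_const)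
      thus "int (pole_mult \<alpha> (map_matrix rat_sharp (Psi u0 u1 v w t))) \<le> int (f \<alpha> (1 / t)) + (rat_ord \<alpha> u0 + rat_ord \<alpha> u1)"
        using pole_mult_inverse[OF Psi_mult_sharp[OF inner us t0], of \<alpha>] by (simp add: pole_mult_transpose f_def)
    qed
    also have "\<dots> \<le> (\<Sum>\<alpha>\<in>S. int (f \<alpha> (1 / t))) - 2" using index by (simp add: sum.distrib)
    finally have plus: "int (d_plus t) + 2 \<le> (\<Sum>\<alpha>\<in>S. int (f \<alpha> (1 / t)))" by simp
    have "(\<Sum>\<alpha>\<in>S. f \<alpha> t) \<le> d_minus t"
      unfolding d_minus_def f_def by (rule sum_pole_mult_le_mcmillan_minus_2) (use circle S in auto)
    hence "(\<Sum>\<alpha>\<in>S. int (f \<alpha> t)) \<le> int (d_minus t)" by (simp flip: of_nat_sum)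
    with plus have "int (d_plus t) + 2 - int (d_minus t) \<le> (\<Sum>\<alpha>\<in>S. int (f \<alpha> (1 / t)) - int (f \<alpha> t))"
      by (simp add: sum_subtractf)
    also have "\<dots> \<le> (\<Sum>\<alpha>\<in>S. max 0 (int (f \<alpha> (1 / t)) - int (f \<alpha> t)))" by (rule sum_mono) simp
    finally show ?thesis by (simp add: sum_nonneg)
  qed
  have local: "(\<Sum>t\<in>F. max 0 (int (f \<alpha> (1 / t)) - int (f \<alpha> t))) \<le> int (n \<alpha>)" if "\<alpha> \<in> S" for \<alpha>
  proof (rule sum_reciprocal_excess[OF F(1)])
    fix s t t' assume "t \<in> F" "t' \<in> F" "t \<noteq> t'"
    thus "f \<alpha> s \<le> max (f \<alpha> t) (f \<alpha> t')"
      unfolding f_def using F(2) by (intro pole_mult_Psi_combination inner) auto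
  next
    fix s t assume "t \<in> F"
    moreover have "ord_ge \<alpha> (- int (n \<alpha>)) u1" unfolding pole_mult_1_le_iff[symmetric] n_def ..
    ultimately show "f \<alpha> s \<le> max (f \<alpha> t) (n \<alpha>)"
      unfolding f_def using F(2) S(2) that by (intro pole_mult_Psi_change inner) auto
  qed
  have "(\<Sum>t\<in>F. max 0 (int (d_plus t) + 2 - int (d_minus t)))
      \<le> (\<Sum>t\<in>F. \<Sum>\<alpha>\<in>S. max 0 (int (f \<alpha> (1 / t)) - int (f \<alpha> t)))"
    by (rule sum_mono) (rule excess)
  also have "\<dots> = (\<Sum>\<alpha>\<in>S. \<Sum>t\<in>F. max 0 (int (f \<alpha> (1 / t)) - int (f \<alpha> t)))" by (rule sum.swap)
  also have "\<dots> \<le> (\<Sum>\<alpha>\<in>S. int (n \<alpha>))" by (rule sum_mono) (rule local)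
  also have "\<dots> \<le> int d"
    unfolding n_def d_def of_nat_sum[symmetric] of_nat_le_iff
    by (rule sum_pole_mult_le_mcmillan_minus_1) (use unimodular_regular uni S in auto)
  finally have total: "(\<Sum>t\<in>F. max 0 (int (d_plus t) + 2 - int (d_minus t))) \<le> int d" .
  have "(\<Sum>t\<in>F. ennreal (max 0 (real (d_plus t) + 2 - real (d_minus t))))
      = ennreal (\<Sum>t\<in>F. max 0 (real (d_plus t) + 2 - real (d_minus t)))"
    by (rule sum_ennreal) simp
  also have "(\<Sum>t\<in>F. max 0 (real (d_plus t) + 2 - real (d_minus t)))
      = real_of_int (\<Sum>t\<in>F. max 0 (int (d_plus t) + 2 - int (d_minus t)))"
    by (simp add: of_int_max)
  also have "ennreal \<dots> \<le> ennreal (real d)"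
    using total by (intro ennreal_leI) linarith
  finally show "(\<Sum>t\<in>F. ennreal (max 0 (real (mcmillan_degree (map_matrix riesz_plus (Psi u0 u1 v w t))) + 2
        - real (mcmillan_degree (map_matrix riesz_minus (Psi u0 u1 v w t))))))
      \<le> ennreal (real (mcmillan_degree ((\<chi> i j. riesz_minus u1) :: ratfun ^ 1 ^ 1)))"
    by (simp only: d_plus_def d_minus_def d_def)
qed (rule nonneg_summable_on_complete, simp)

end
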